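(* Let $\Bbbk$ be a field, let $P\ne Q$ be two $\Bbbk$-rational points of $\mathbb{P}^1_{\Bbbk}$, let $\alpha,\beta\in\mathbb{Q}$ with $\alpha+\beta\ge0$, and let $D=\alpha P+\beta Q$. Let $t$ be a rational coordinate on $\mathbb{P}^1$ with a pole at $P$ and a zero at $Q$. Let $c_0/d_0$ be a rational number in the closed interval $[-\beta,\alpha]$ of minimal denominator (written in lowest terms, $d_0>0$). Let $$\frac{c_0}{d_0}<\frac{c_1}{d_1}<\cdots<\frac{c_r}{d_r}=\alpha$$ be the subsequent best lower approximations of $\alpha$ (i.e. all those greater than $c_0/d_0$), and let $$\frac{c_0}{d_0}>\frac{c_{-1}}{d_{-1}}>\cdots>\frac{c_{-s}}{d_{-s}}=-\beta$$ be the best upper approximations of $-\beta$ following $c_0/d_0$ (i.e. all those less than $c_0/d_0$). Then the canonical ring $S=S_D$ has a minimal presentation consisting of the $r+s+1$ generators $f_i=t^{c_i}u^{d_i}$ ($-s\le i\le r$) and $\binom{r+s}{2}$ relations, one for each pair $(i,j)$ with $-s\le i$, $j\le r$, $j\ge i+2$, each of one of the two forms $$g_{ij}=f_if_j-f_{h_{ij}}^{a_{ij}}\quad (i<h_{ij}<j)\qquad\text{or}\qquad g_{ij}=f_if_j-f_{h_{ij}}^{a_{ij}}f_{h_{ij}+1}^{b_{ij}}\quad(i<h_{ij}<h_{ij}+1<j),$$ where $h_{ij}$ is an integer and $a_{ij},b_{ij}$ are positive integers.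
   Context: For a $\mathbb{Q}$-divisor $D=\sum_i\alpha_iP_i$ on $\mathbb{P}^1_{\Bbbk}$, put $\lfloor dD\rfloor=\sum_i\lfloor d\alpha_i\rfloor P_i$. The canonical ring of $D$ is the graded $\Bbbk$-algebra $S_D=\bigoplus_{d\ge0}u^dH^0(\mathbb{P}^1,O(\lfloor dD\rfloor))\subseteq \Bbbk(t)[u]$, where $H^0(\mathbb{P}^1,O(E))$ is the space of rational functions $f$ with $f=0$ or $\operatorname{div}(f)+E\ge0$, and $u$ is a dummy variable recording the degree. A best lower approximation to a real number $\alpha$ is a fraction $c/d\le\alpha$ ($c,d\in\mathbb{Z}$, $d>0$) such that there is no fraction $c'/d'$ ($d'>0$) with $c/d\le c'/d'\le\alpha$ but $d'<d$. A best upper approximation to $\alpha$ is the negative of a best lower approximation to $-\alpha$. "Minimal presentation" means: the $f_i$ form a minimal set of generators of the $\Bbbk$-algebra $S$, and the kernel of the surjection $\Bbbk[x_{-s},\dots,x_r]\to S$, $x_i\mapsto f_i$, is minimally generated as an ideal by the polynomials obtained from the $g_{ij}$ by replacing each $f_i$ by $x_i$. *)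

theory Defs
  imports
    "HOL-Algebra.Generated_Rings"
    "HOL-Algebra.Ideal"
    "HOL-Library.Poly_Mapping"
    "HOL-Computational_Algebra.Polynomial_Factorial"
begin

subsection \<open>The projective line and its function field\<close>

text \<open>
  The function field of the projective line over a field \<^typ>\<open>'a\<close> is \<^typ>\<open>'a poly fract\<close>, the
  rational functions in a standard affine coordinate \<open>x\<close>. The closed points are the point at
  infinity, encoded as \<^term>\<open>None\<close>, and one point \<^term>\<open>Some p\<close> for each monic irreducible
  polynomial \<open>p\<close> in \<open>x\<close>; the rational point \<open>x = a\<close> is \<^term>\<open>Some [:- a, 1:]\<close>.
\<close>

type_synonym 'a p1_point = "'a poly option"

definition closed_points :: "'a::field p1_point set" where
  "closed_points = insert None (Some ` {p. irreducible p \<and> lead_coeff p = 1})"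

definition rational_points :: "'a::field p1_point set" where
  "rational_points = insert None (range (\<lambda>a. Some [:- a, 1:]))"

text \<open>The library's \<open>multiplicity\<close> does not apply, since it needs a stronger sort than
  \<^class>\<open>field\<close> on the coefficients. Only meaningful for \<open>a \<noteq> 0\<close> and non-constant \<open>p\<close>.\<close>

definition poly_multiplicity :: "'a::field poly \<Rightarrow> 'a poly \<Rightarrow> nat" where
  "poly_multiplicity p a = Max {n. p ^ n dvd a}"

lemma poly_multiplicity_eqI:
  fixes p a b :: "'a::field poly"
  assumes "irreducible p" "a = p ^ m * b" "\<not> p dvd b"
  shows "poly_multiplicity p a = m"
proof -
  have p0: "p \<noteq> 0" using assms(1) by auto
  have "p ^ n dvd a \<longleftrightarrow> n \<le> m" for n
  proof
    assume n: "p ^ n dvd a"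
    show "n \<le> m"
    proof (rule ccontr)
      assume "\<not> n \<le> m"
      then have "p ^ (m + 1) dvd p ^ m * b" using n assms(2)
        by (metis Suc_eq_plus1 dvd_trans le_imp_power_dvd not_less_eq_eq)
      then show False using p0 assms(3) by simp
    qed
  qed (use assms(2) in \<open>auto simp: le_imp_power_dvd\<close>)
  then have "{n. p ^ n dvd a} = {..m}" by auto
  then show ?thesis by (auto simp: poly_multiplicity_def intro!: Max_eqI)
qed

lemma poly_multiplicity_decomp:
  fixes p a :: "'a::field poly"
  assumes "irreducible p" "a \<noteq> 0"
  obtains b where "a = p ^ poly_multiplicity p a * b" "\<not> p dvd b"
proof -
  have "degree p > 0" using assms(1) is_unit_iff_degree[of p] by (auto simp: irreducible_def)
  then have "\<exists>m b. a = p ^ m * b \<and> \<not> p dvd b" using assms(2)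
  proof (induction "degree a" arbitrary: a rule: less_induct)
    case less
    show ?case
    proof (cases "p dvd a")
      case True
      then obtain c where c: "a = p * c" by auto
      with less.prems have "c \<noteq> 0" "p \<noteq> 0" by auto
      then have "degree c < degree a" using less.prems c by (simp add: degree_mult_eq)
      from less.hyps[OF this less.prems(1) \<open>c \<noteq> 0\<close>] obtain m b
        where "c = p ^ m * b" "\<not> p dvd b" by auto
      then have "a = p ^ Suc m * b" using c by (simp add: mult.assoc)
      with \<open>\<not> p dvd b\<close> show ?thesis by blast
    next
      case False
      then show ?thesis by (intro exI[of _ 0] exI[of _ a]) auto
    qed
  qed
  then obtain m b where mb: "a = p ^ m * b" "\<not> p dvd b" by auto
  with poly_multiplicity_eqI[OF assms(1) this] that show thesis by auto
qed

lemma poly_multiplicity_mult: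
  fixes p a b :: "'a::field poly"
  assumes "irreducible p" "a \<noteq> 0" "b \<noteq> 0"
  shows "poly_multiplicity p (a * b) = poly_multiplicity p a + poly_multiplicity p b"
proof -
  obtain a' where a': "a = p ^ poly_multiplicity p a * a'" "\<not> p dvd a'"
    using poly_multiplicity_decomp assms by blast
  obtain b' where b': "b = p ^ poly_multiplicity p b * b'" "\<not> p dvd b'"
    using poly_multiplicity_decomp assms by blast
  have "prime_elem p" using assms(1) by (rule field_poly_irreducible_imp_prime)
  then have "\<not> p dvd a' * b'" using a' b' by (simp add: prime_elem_dvd_mult_iff)
  moreover have "a * b = p ^ (poly_multiplicity p a + poly_multiplicity p b) * (a' * b')"
    by (subst a'(1), subst b'(1)) (simp add: power_add algebra_simps)
  ultimately show ?thesis using poly_multiplicity_eqI[OF assms(1)] by blast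
qed

text \<open>The coefficient of \<open>div(a/b)\<close> at a closed point; only meaningful for \<open>a \<noteq> 0\<close>.\<close>

fun quot_order :: "'a::field p1_point \<Rightarrow> 'a poly \<Rightarrow> 'a poly \<Rightarrow> int" where
  "quot_order None a b = int (degree b) - int (degree a)"
| "quot_order (Some p) a b = int (poly_multiplicity p a) - int (poly_multiplicity p b)"

definition place_order :: "'a::field p1_point \<Rightarrow> 'a poly fract \<Rightarrow> int" where
  "place_order X f =
     (let (a, b) = (SOME (a, b). b \<noteq> 0 \<and> f = Fraction_Field.Fract a b) in quot_order X a b)"

text \<open>The order does not depend on the representative chosen above.\<close>

lemma place_order_Fract:
  assumes "X \<in> closed_points" "a \<noteq> 0" "b \<noteq> 0"
  shows "place_order X (Fraction_Field.Fract a b) = quot_order X a b"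
proof -
  let ?P = "\<lambda>(c, d). d \<noteq> 0 \<and> Fraction_Field.Fract a b = Fraction_Field.Fract c d"
  obtain c d where cd: "(SOME z. ?P z) = (c, d)" by (cases "SOME z. ?P z") auto
  have "?P (SOME z. ?P z)" by (rule someI[of ?P "(a, b)"]) (use assms in auto)
  then have d: "d \<noteq> 0" "a * d = c * b" unfolding cd using assms by (auto simp: eq_fract)
  then have c: "c \<noteq> 0" using assms by auto
  have "quot_order X c d = quot_order X a b"
  proof (cases X)
    case None
    have "degree (a * d) = degree (c * b)" using d by simp
    then have "degree a + degree d = degree c + degree b"
      using assms(2,3) c d(1) by (metis Polynomial.degree_mult_eq)
    then show ?thesis using None by simp
  next
    case (Some p)
    then have p: "irreducible p" using assms(1) by (auto simp: closed_points_def)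
    have "poly_multiplicity p (a * d) = poly_multiplicity p (c * b)" using d by simp
    then have "poly_multiplicity p a + poly_multiplicity p d =
        poly_multiplicity p c + poly_multiplicity p b"
      using p assms(2,3) c d(1) by (metis poly_multiplicity_mult)
    then show ?thesis using Some by simp
  qed
  then show ?thesis by (simp add: place_order_def cd)
qed

text \<open>
  Coordinates on the projective line are the images of \<open>x\<close> under its automorphisms, i.e. the
  fractional linear transformations of \<open>x\<close>.
\<close>

definition rational_coordinate :: "'a::field poly fract \<Rightarrow> bool" where
  "rational_coordinate t \<longleftrightarrow>
     (\<exists>a b c d. a * d - b * c \<noteq> 0 \<and> t = Fraction_Field.Fract [:b, a:] [:d, c:])"

subsection \<open>Canonical rings of \<open>\<rat>\<close>-divisors\<close>

type_synonym ('a, 'b) divisor = "'a p1_point \<Rightarrow>\<^sub>0 'b"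

definition global_sections :: "('a::field, int) divisor \<Rightarrow> 'a poly fract set" where
  "global_sections E =
     {f. f = 0 \<or> (\<forall>X\<in>closed_points. place_order X f + Poly_Mapping.lookup E X \<ge> 0)}"

definition floor_multiple :: "nat \<Rightarrow> ('a, rat) divisor \<Rightarrow> ('a, int) divisor" where
  "floor_multiple n D = Poly_Mapping.map (\<lambda>q. \<lfloor>of_nat n * q\<rfloor>) D"

text \<open>Elements are polynomials in the dummy variable \<open>u\<close> over the function field.\<close>

definition canonical_ring :: "('a::field, rat) divisor \<Rightarrow> 'a poly fract poly ring" where
  "canonical_ring D =
     \<lparr>carrier = {F. \<forall>n. Polynomial.coeff F n \<in> global_sections (floor_multiple n D)},
      monoid.mult = (*), one = 1, zero = 0, add = (+)\<rparr>"

definition const_fun :: "'a::field \<Rightarrow> 'a poly fract poly" where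
  "const_fun a = [:to_fract [:a:]:]"

subsection \<open>Minimal presentations\<close>

text \<open>Polynomials over \<^typ>\<open>'a\<close> in variables indexed by \<^typ>\<open>int\<close>: finitely supported maps from
  exponent vectors to coefficients, with convolution as multiplication.\<close>

type_synonym 'a mpolynomial = "(int \<Rightarrow>\<^sub>0 nat) \<Rightarrow>\<^sub>0 'a"

definition Var :: "int \<Rightarrow> 'a::field mpolynomial" where
  "Var i = Poly_Mapping.single (Poly_Mapping.single i 1) 1"

definition mpoly_ring :: "int set \<Rightarrow> 'a::field mpolynomial ring" where
  "mpoly_ring I =
     \<lparr>carrier = {p. \<forall>m\<in>Poly_Mapping.keys p. Poly_Mapping.keys m \<subseteq> I},
      monoid.mult = (*), one = 1, zero = 0, add = (+)\<rparr>"

definition eval_mpoly ::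
    "(int \<Rightarrow> 'a::field poly fract poly) \<Rightarrow> 'a mpolynomial \<Rightarrow> 'a poly fract poly" where
  "eval_mpoly f p =
     (\<Sum>m\<in>Poly_Mapping.keys p. const_fun (Poly_Mapping.lookup p m) *
        (\<Prod>i\<in>Poly_Mapping.keys m. f i ^ Poly_Mapping.lookup m i))"

definition generates_algebra ::
    "'a::field poly fract poly ring \<Rightarrow> 'a poly fract poly set \<Rightarrow> bool" where
  "generates_algebra S A \<longleftrightarrow>
     A \<subseteq> carrier S \<and> generate_ring S (range const_fun \<union> A) = carrier S"

definition minimal_generators ::
    "'a::field poly fract poly ring \<Rightarrow> int set \<Rightarrow> (int \<Rightarrow> 'a poly fract poly) \<Rightarrow> bool" where
  "minimal_generators S I f \<longleftrightarrow>
     generates_algebra S (f ` I) \<and> (\<forall>J. J \<subset> I \<longrightarrow> \<not> generates_algebra S (f ` J))"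

definition minimal_ideal_generators ::
    "('b, 'm) ring_scheme \<Rightarrow> 'b set \<Rightarrow> 'b set \<Rightarrow> bool" where
  "minimal_ideal_generators R K G \<longleftrightarrow>
     G \<subseteq> carrier R \<and> Idl\<^bsub>R\<^esub> G = K \<and> (\<forall>H. H \<subset> G \<longrightarrow> Idl\<^bsub>R\<^esub> H \<noteq> K)"

definition minimal_presentation ::
    "'a::field poly fract poly ring \<Rightarrow> int set \<Rightarrow> (int \<Rightarrow> 'a poly fract poly) \<Rightarrow>
     'a mpolynomial set \<Rightarrow> bool" where
  "minimal_presentation S I f G \<longleftrightarrow>
     minimal_generators S I f \<and>
     minimal_ideal_generators (mpoly_ring I) (a_kernel (mpoly_ring I) S (eval_mpoly f)) G"

subsection \<open>Best approximations\<close>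

text \<open>A pair \<open>c d\<close> stands for the fraction \<open>c/d\<close>; the minimality condition forces it to be in
  lowest terms.\<close>

definition best_lower_approx :: "'b::linordered_field \<Rightarrow> int \<Rightarrow> nat \<Rightarrow> bool" where
  "best_lower_approx \<alpha> c d \<longleftrightarrow>
     0 < d \<and> of_int c / of_nat d \<le> \<alpha> \<and>
     \<not> (\<exists>c' d'. 0 < d' \<and> of_int c / of_nat d \<le> (of_int c' / of_nat d' :: 'b) \<and>
                of_int c' / of_nat d' \<le> \<alpha> \<and> d' < d)"

definition best_upper_approx :: "'b::linordered_field \<Rightarrow> int \<Rightarrow> nat \<Rightarrow> bool" where
  "best_upper_approx \<alpha> c d \<longleftrightarrow> best_lower_approx (- \<alpha>) (- c) d"

end

theory Submission
  imports Defs "HOL-Library.Product_Plus"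
begin

text \<open>
  The canonical ring is the algebra of the monoid of lattice points \<open>(c, d)\<close>, \<open>d \<ge> 0\<close>, with
  \<open>- \<beta> d \<le> c \<le> \<alpha> d\<close>: after clearing the poles at \<open>P\<close> and \<open>Q\<close>, sections become polynomials of
  bounded degree, and these are spanned by products of powers of the numerator and the denominator
  of \<open>t\<close>. The irreducible elements of the monoid are exactly the listed best approximations, and
  by Cramer's rule two consecutive irreducible elements span all monoid elements between them. So
  every monoid element is uniquely \<open>a v\<^sub>h + b v\<^bsub>h+1\<^esub>\<close>; for \<open>v\<^sub>i + v\<^sub>j\<close> with \<open>j \<ge> i + 2\<close> this gives the
  relation \<open>g\<^sub>i\<^sub>j\<close>. The relations rewrite every monomial to its normal form, hence generate the
  kernel, and none is redundant since only \<open>g\<^sub>i\<^sub>j\<close> contains a monomial dividing \<open>x\<^sub>i x\<^sub>j\<close>.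
\<close>

subsection \<open>Irreducible lattice points of plane cones\<close>

text \<open>Best approximations look at one end of the interval, whereas a decomposition in the
  monoid may involve points near both ends. The point of minimal denominator \<open>d 0\<close>
  decouples the two: no nonzero point of the monoid has a smaller denominator, so it is irreducible
  itself, and on either side of it bestness and irreducibility agree. The two sides are exchanged by
  the sign change of \<open>c\<close>, which swaps \<alpha> and \<beta>. All of the plane geometry
  rests on one closure property, saturation. Consecutive irreducible points are never shown to have
  determinant one: spanning with natural coefficients comes directly from induction on the
  denominator, and uniqueness uses only that the determinant is positive. In the degenerate case
  \<alpha> = - \<beta> the cone is a single ray with one generator.\<close>

text \<open>The lattice point \<open>(c, d)\<close> stands for the slope \<open>c / d\<close>; for positive denominators
  \<open>wedge u v\<close> has the sign of the difference of the slopes of \<open>v\<close> and \<open>u\<close>.\<close>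

definition wedge :: "int \<times> int \<Rightarrow> int \<times> int \<Rightarrow> int" where
  "wedge u v = snd u * fst v - fst u * snd v"

lemma wedge_add_left: "wedge (u + v) w = wedge u w + wedge v w"
  and wedge_add_right: "wedge w (u + v) = wedge w u + wedge w v"
  and wedge_diff_left: "wedge (u - v) w = wedge u w - wedge v w"
  and wedge_diff_right: "wedge w (u - v) = wedge w u - wedge w v"
  and wedge_self [simp]: "wedge u u = 0"
  and wedge_zero [simp]: "wedge 0 u = 0" "wedge u 0 = 0"
  by (simp_all add: wedge_def algebra_simps)

lemma wedge_flip: "wedge u v = - wedge v u"
  by (simp add: wedge_def algebra_simps)

text \<open>Three vectors of the plane are dependent: \<open>b\<close> times
  \<open>wedge a c\<close> is \<open>a\<close> times \<open>wedge b c\<close> plus \<open>c\<close>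
  times \<open>wedge a b\<close>. This is the second coordinate of that relation; it turns
  comparisons of slopes into sign arguments without division.\<close>

lemma wedge_plucker: "snd b * wedge a c = snd a * wedge b c + snd c * wedge a b"
  by (simp add: wedge_def algebra_simps)

lemma wedge_trans:
  assumes "0 \<le> wedge a b" "0 \<le> wedge b c" "0 \<le> snd a" "0 < snd b" "0 \<le> snd c"
  shows "0 \<le> wedge a c"
proof -
  have "0 \<le> snd b * wedge a c"
    unfolding wedge_plucker[of b a c] using assms by (intro add_nonneg_nonneg mult_nonneg_nonneg) auto
  then show ?thesis using assms(4) by (simp add: zero_le_mult_iff)
qed

lemma wedge_less_trans1:
  assumes "0 < wedge a b" "0 \<le> wedge b c" "0 \<le> snd a" "0 < snd b" "0 < snd c"
  shows "0 < wedge a c"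
proof -
  have "0 < snd b * wedge a c"
    unfolding wedge_plucker[of b a c] using assms
    by (intro add_nonneg_pos mult_nonneg_nonneg mult_pos_pos) auto
  then show ?thesis using assms(4) by (simp add: zero_less_mult_iff)
qed

text \<open>By \<open>saturated\<close>, lattice points of the rational cone over two elements
  belong to \<open>M\<close>; \<open>k\<close> is a common denominator, so that Cramer's rule can
  supply \<open>p\<close>, \<open>q\<close> and \<open>k\<close> as wedges. \<open>snd_pos\<close>
  makes the denominator usable as an induction measure.\<close>

locale saturated_monoid =
  fixes M :: "(int \<times> int) set"
  assumes zero_mem: "0 \<in> M"
    and snd_pos: "w \<in> M \<Longrightarrow> w \<noteq> 0 \<Longrightarrow> 0 < snd w"
    and saturated: "a \<in> M \<Longrightarrow> b \<in> M \<Longrightarrow> 0 \<le> p \<Longrightarrow> 0 \<le> q \<Longrightarrow> 0 < k \<Longrightarrow>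
      k * fst z = p * fst a + q * fst b \<Longrightarrow> k * snd z = p * snd a + q * snd b \<Longrightarrow> z \<in> M"
begin

definition irred :: "int \<times> int \<Rightarrow> bool" where
  "irred x \<longleftrightarrow> x \<in> M \<and> x \<noteq> 0 \<and> (\<forall>a\<in>M. \<forall>b\<in>M. x = a + b \<longrightarrow> a = 0 \<or> b = 0)"

lemma snd_nonneg: "w \<in> M \<Longrightarrow> 0 \<le> snd w"
  using snd_pos[of w] by (cases "w = 0") auto

lemma add_mem: "a \<in> M \<Longrightarrow> b \<in> M \<Longrightarrow> a + b \<in> M"
  by (rule saturated[of a b 1 1 1]) auto

lemma irredD:
  assumes "irred x" "a \<in> M" "x - a \<in> M"
  shows "a = 0 \<or> x = a"
  using assms by (auto simp: irred_def)

text \<open>By irreducibility of \<open>x\<close>, both coefficients of \<open>x\<close> with respect to \<open>a\<close> and \<open>b\<close> are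
  below \<open>1\<close>.\<close>

lemma add_diff_irred_mem:
  assumes x: "irred x" and ab: "a \<in> M" "b \<in> M" and ax: "0 < wedge a x" and xb: "0 < wedge x b"
  shows "a + b - x \<in> M" "wedge a x < wedge a b" "wedge x b < wedge a b"
proof -
  have M: "x \<in> M" using x by (simp add: irred_def)
  have nz: "a \<noteq> 0" "b \<noteq> 0" "x \<noteq> 0" using ax xb by auto
  have D: "0 < wedge a b"
    by (rule wedge_less_trans1[OF ax]) (use xb M ab nz in \<open>auto intro: snd_pos snd_nonneg\<close>)
  have ne: "x \<noteq> a" "x \<noteq> b" using ax xb by auto
  have 1: "wedge x b < wedge a b"
  proof (rule ccontr)
    assume n: "\<not> ?thesis"
    \<comment> \<open>Cramer's rule: \<open>wedge a b\<close> times \<open>x\<close> is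
      \<open>wedge x b\<close> times \<open>a\<close> plus \<open>wedge a x\<close> times
      \<open>b\<close>. Subtracting \<open>a\<close> lowers the first coefficient by
      \<open>wedge a b\<close>.\<close>
    have "x - a \<in> M"
      by (rule saturated[of a b "wedge x b - wedge a b" "wedge a x" "wedge a b"])
        (use n ab ax D in \<open>simp_all, simp_all add: wedge_def algebra_simps\<close>)
    then show False using irredD[OF x ab(1)] nz ne by auto
  qed
  have 2: "wedge a x < wedge a b"
  proof (rule ccontr)
    assume n: "\<not> ?thesis"
    have "x - b \<in> M"
      by (rule saturated[of a b "wedge x b" "wedge a x - wedge a b" "wedge a b"])
        (use n ab xb D in \<open>simp_all, simp_all add: wedge_def algebra_simps\<close>)
    then show False using irredD[OF x ab(2)] nz ne by auto
  qed
  show "wedge a x < wedge a b" "wedge x b < wedge a b" by fact+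
  show "a + b - x \<in> M"
    by (rule saturated[of a b "wedge a b - wedge x b" "wedge a b - wedge a x" "wedge a b"])
      (use ab 1 2 D in \<open>simp_all, simp_all add: wedge_def algebra_simps\<close>)
qed

text \<open>If \<open>w = a + b\<close> and a summand leaves the sector between \<open>x\<close> and \<open>y\<close>, then \<open>w - x\<close> or
  \<open>w - y\<close> lies in \<open>M\<close> and in the sector.\<close>

lemma consecutive_irreds_span:
  assumes x: "irred x" and y: "irred y"
    and consec: "\<And>v. irred v \<Longrightarrow> 0 \<le> wedge x v \<Longrightarrow> 0 \<le> wedge v y \<Longrightarrow> v = x \<or> v = y"
    and "w \<in> M" "0 \<le> wedge x w" "0 \<le> wedge w y"
  shows "\<exists>(a::nat) (b::nat). fst w = a * fst x + b * fst y \<and> snd w = a * snd x + b * snd y"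
  using assms(4-6)
proof (induction "nat (snd w)" arbitrary: w rule: less_induct)
  case less
  let ?span = "\<lambda>w. \<exists>(a::nat) (b::nat). fst w = a * fst x + b * fst y \<and> snd w = a * snd x + b * snd y"
  have xM: "x \<in> M" "x \<noteq> 0" "0 < snd x" and yM: "y \<in> M" "y \<noteq> 0" "0 < snd y"
    using x y snd_pos[of x] snd_pos[of y] by (auto simp: irred_def)
  have span_add: "?span (a + b)" if "?span a" "?span b" for a b
  proof -
    from that obtain k l m n :: nat where
      "fst a = k * fst x + l * fst y" "snd a = k * snd x + l * snd y"
      "fst b = m * fst x + n * fst y" "snd b = m * snd x + n * snd y" by auto
    then show ?thesis by (intro exI[of _ "k + m"] exI[of _ "l + n"]) (auto simp: algebra_simps)
  qed
  have spx: "?span x" by (rule exI[of _ 1], rule exI[of _ 0]) auto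
  have spy: "?span y" by (rule exI[of _ 0], rule exI[of _ 1]) auto
  \<comment> \<open>It is enough to remove one copy of \<open>x\<close> or \<open>y\<close> such
    that the rest stays in the sector: the denominator drops and induction applies.\<close>
  have sub: "?span w" if "v \<in> {x, y}" "w - v \<in> M" "0 \<le> wedge x (w - v)" "0 \<le> wedge (w - v) y" for v
  proof -
    have "0 < snd v" using that xM yM by auto
    moreover have "0 \<le> snd (w - v)" using that(2) by (rule snd_nonneg)
    ultimately have "nat (snd (w - v)) < nat (snd w)" by auto
    then have "?span (w - v)" using that by (intro less.hyps) auto
    moreover have "?span v" using that(1) spx spy by blast
    ultimately have "?span ((w - v) + v)" by (rule span_add)
    then show ?thesis by (simp only: diff_add_cancel)
  qed
  consider "w = 0" | "irred w" | a b where "a \<in> M" "b \<in> M" "w = a + b" "a \<noteq> 0" "b \<noteq> 0" "w \<noteq> 0"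
    using less.prems unfolding irred_def by metis
  then show ?case
  proof cases
    case 1 then show ?thesis by (intro exI[of _ 0]) auto
  next
    case 2
    then have "w = x \<or> w = y" using consec less.prems by auto
    then show ?thesis using spx spy by auto
  next
    case 3
    \<comment> \<open>With slopes ordered as \<open>a\<close>, \<open>w\<close>, \<open>b\<close>,
      the summand \<open>a\<close> cannot lie above \<open>y\<close>, nor \<open>b\<close> below
      \<open>x\<close>. The sector can only be left by \<open>a\<close> below \<open>x\<close> or by
      \<open>b\<close> above \<open>y\<close>.\<close>
    have split: "?span w"
      if ab: "a \<in> M" "b \<in> M" "w = a + b" "a \<noteq> 0" "b \<noteq> 0" and s: "0 \<le> wedge a b" for a b
    proof -
      have pos: "0 < snd a" "0 < snd b" using ab snd_pos[of a] snd_pos[of b] by auto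
      have aw: "0 \<le> wedge a w" and wb: "0 \<le> wedge w b"
        using s by (auto simp: ab(3) wedge_add_left wedge_add_right)
      have wpos: "0 < snd w" using pos by (simp add: ab(3))
      have ay: "0 \<le> wedge a y"
        by (rule wedge_trans[OF aw]) (use less.prems(2,3) pos wpos yM in auto)
      have xb: "0 \<le> wedge x b"
        by (rule wedge_trans[OF _ wb]) (use less.prems(2,3) pos wpos xM in auto)
      show ?thesis
      proof (cases "0 \<le> wedge x a")
        case xa: True
        show ?thesis
        proof (cases "0 \<le> wedge b y")
          case True
          have "?span a" using ab(1) pos xa ay by (intro less.hyps) (simp_all add: ab(3))
          moreover have "?span b" using ab(2) pos xb True by (intro less.hyps) (simp_all add: ab(3))
          ultimately show ?thesis unfolding ab(3) by (rule span_add)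
        next
          case False
          then have yb: "0 < wedge y b" using wedge_flip[of y b] by simp
          show ?thesis
          proof (cases "wedge a y = 0")
            case True
            have "wedge y w = wedge y a + wedge y b" by (simp add: ab(3) wedge_add_right)
            then have False using yb True less.prems(3) wedge_flip[of y a] wedge_flip[of y w] by linarith
            then show ?thesis ..
          next
            case False
            with ay have ay: "0 < wedge a y" by simp
            have M: "w - y \<in> M" using add_diff_irred_mem(1)[OF y ab(1,2) ay yb] by (simp only: ab(3))
            have up: "0 \<le> wedge (w - y) y" using less.prems by (simp add: wedge_diff_left)
            show ?thesis
            proof (cases "0 \<le> wedge x (w - y)")
              case True
              then show ?thesis using M up True by (intro sub[of y]) simp_all
            next
              case False
              \<comment> \<open>Now \<open>w - y\<close> lies below \<open>x\<close>, so
                \<open>x\<close> separates \<open>w - y\<close> from \<open>y\<close>. These two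
                have sum \<open>w\<close>, hence \<open>w - x\<close> is in \<open>M\<close>, and
                the coefficient bound keeps \<open>w - x\<close> below \<open>y\<close>.\<close>
              have x1: "0 < wedge (w - y) x" using False wedge_flip[of x "w - y"] by simp
              have x2: "0 \<le> wedge x y"
                by (rule wedge_trans[of x w y]) (use less.prems(2,3) wpos xM yM in auto)
              have "wedge x (w - y) = wedge x w - wedge x y" by (simp add: wedge_diff_right)
              then have x2: "0 < wedge x y" using False less.prems by linarith
              have "w - x \<in> M" using add_diff_irred_mem(1)[OF x M yM(1) x1 x2] by simp
              moreover have "0 \<le> wedge x (w - x)" using less.prems by (simp add: wedge_diff_right)
              moreover have "0 \<le> wedge (w - x) y"
              proof -
                have "wedge (w - x) y = wedge (w - y) y - wedge x y" by (simp add: wedge_diff_left)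
                moreover have "wedge x y < wedge (w - y) y"
                  using add_diff_irred_mem(3)[OF x M yM(1) x1 x2] .
                ultimately show ?thesis by simp
              qed
              ultimately show ?thesis by (intro sub[of x]) simp_all
            qed
          qed
        qed
      next
        case False
        then have ax: "0 < wedge a x" using wedge_flip[of a x] by simp
        have xb: "0 < wedge x b"
        proof (rule ccontr)
          assume "\<not> ?thesis"
          moreover have "wedge x w = wedge x a + wedge x b" by (simp add: ab(3) wedge_add_right)
          ultimately show False using less.prems(2) ax wedge_flip[of a x] by linarith
        qed
        \<comment> \<open>Mirror image of the previous case: \<open>x\<close> separates
          \<open>a\<close> from \<open>b\<close>, and if \<open>w - x\<close> leaves the sector
          above \<open>y\<close>, then \<open>y\<close> separates \<open>x\<close> from
          \<open>w - x\<close>.\<close>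
        have M: "w - x \<in> M" using add_diff_irred_mem(1)[OF x ab(1,2) ax xb] by (simp only: ab(3))
        have lo: "0 \<le> wedge x (w - x)" using less.prems by (simp add: wedge_diff_right)
        show ?thesis
        proof (cases "0 \<le> wedge (w - x) y")
          case True
          then show ?thesis using M lo True by (intro sub[of x]) simp_all
        next
          case False
          have y1: "0 < wedge y (w - x)" using False wedge_flip[of y "w - x"] by simp
          have "wedge (w - x) y = wedge w y - wedge x y" by (simp add: wedge_diff_left)
          then have y2: "0 < wedge x y" using False less.prems by linarith
          have "w - y \<in> M" using add_diff_irred_mem(1)[OF y xM(1) M y2 y1] by simp
          moreover have "0 \<le> wedge (w - y) y" using less.prems by (simp add: wedge_diff_left)
          moreover have "0 \<le> wedge x (w - y)"
          proof -
            have "wedge x (w - y) = wedge x (w - x) - wedge x y" by (simp add: wedge_diff_right)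
            moreover have "wedge x y < wedge x (w - x)"
              using add_diff_irred_mem(2)[OF y xM(1) M y2 y1] .
            ultimately show ?thesis by simp
          qed
          ultimately show ?thesis by (intro sub[of y]) simp_all
        qed
      qed
    qed
    show ?thesis
    proof (cases "0 \<le> wedge a b")
      case True then show ?thesis using 3 by (intro split[of a b]) simp_all
    next
      case False
      then have "0 \<le> wedge b a" using wedge_flip[of b a] by simp
      then show ?thesis using 3 by (intro split[of b a]) (simp_all add: add.commute)
    qed
  qed
qed

end

section \<open>Normal forms over consecutive irreducible points\<close>

locale hilbert_basis = saturated_monoid +
  fixes v :: "int \<Rightarrow> int \<times> int" and lo hi :: int
  assumes lo_le_hi: "lo \<le> hi"
    and irred_iff: "irred w \<longleftrightarrow> (\<exists>i\<in>{lo..hi}. w = v i)"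
    and wedge_gens: "lo \<le> i \<Longrightarrow> i < j \<Longrightarrow> j \<le> hi \<Longrightarrow> 0 < wedge (v i) (v j)"
    and wedge_lo: "w \<in> M \<Longrightarrow> 0 \<le> wedge (v lo) w"
    and wedge_hi: "w \<in> M \<Longrightarrow> 0 \<le> wedge w (v hi)"
begin

text \<open>Requiring \<open>0 < a\<close> assigns a point on the ray of a generator to that
  generator alone, which makes the form unique. For \<open>h = hi\<close> the condition forces
  \<open>b = 0\<close>, so that the value of \<open>v\<close> beyond the range is multiplied by
  zero.\<close>

definition normal_rep :: "int \<Rightarrow> nat \<Rightarrow> nat \<Rightarrow> int \<times> int \<Rightarrow> bool" where
  "normal_rep h a b w \<longleftrightarrow> lo \<le> h \<and> h \<le> hi \<and> 0 < a \<and> (0 < b \<longrightarrow> h + 1 \<le> hi) \<and>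
     fst w = a * fst (v h) + b * fst (v (h + 1)) \<and> snd w = a * snd (v h) + b * snd (v (h + 1))"

lemma irred_gen: "lo \<le> i \<Longrightarrow> i \<le> hi \<Longrightarrow> irred (v i)"
  using irred_iff by auto

lemma gen_mem: "lo \<le> i \<Longrightarrow> i \<le> hi \<Longrightarrow> v i \<in> M"
  and gen_nonzero: "lo \<le> i \<Longrightarrow> i \<le> hi \<Longrightarrow> v i \<noteq> 0"
  and gen_snd_pos: "lo \<le> i \<Longrightarrow> i \<le> hi \<Longrightarrow> 0 < snd (v i)"
  using irred_gen[of i] snd_pos[of "v i"] by (auto simp: irred_def)

lemma normal_rep_wedge_right:
  "normal_rep h a b w \<Longrightarrow> wedge u w = a * wedge u (v h) + b * wedge u (v (h + 1))"
  by (simp add: normal_rep_def wedge_def algebra_simps)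

lemma normal_rep_wedge_left:
  "normal_rep h a b w \<Longrightarrow> wedge w u = a * wedge (v h) u + b * wedge (v (h + 1)) u"
  by (simp add: normal_rep_def wedge_def algebra_simps)

text \<open>Supplies the consecutiveness hypothesis of the spanning lemma. The choice
  \<open>k = h\<close> serves the last generator, where the sector degenerates to a ray.\<close>

lemma gens_between:
  assumes h: "lo \<le> h" "h \<le> hi" and k: "k = h \<or> k = h + 1" "k \<le> hi"
    and w: "irred w" "0 \<le> wedge (v h) w" "0 \<le> wedge w (v k)"
  shows "w = v h \<or> w = v k"
proof -
  from w obtain i where i: "lo \<le> i" "i \<le> hi" "w = v i" using irred_iff by auto
  have "h \<le> i" using wedge_gens[of i h] w(2) wedge_flip[of "v i" "v h"] i h by force
  moreover have "i \<le> k" using wedge_gens[of k i] w(3) wedge_flip[of "v i" "v k"] i h k by force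
  ultimately have "i = h \<or> i = k" using k by linarith
  then show ?thesis using i by auto
qed

lemma normal_rep_exists:
  assumes w: "w \<in> M" "w \<noteq> 0"
  obtains h a b where "normal_rep h a b w"
proof -
  \<comment> \<open>The sector of \<open>w\<close> starts at the last generator whose slope does not
    exceed that of \<open>w\<close>. By maximality \<open>w\<close> lies strictly below the next
    generator, and this is what makes \<open>a\<close> positive.\<close>
  define H where "H = {i\<in>{lo..hi}. 0 \<le> wedge (v i) w}"
  have "H \<subseteq> {lo..hi}" by (auto simp: H_def)
  then have H: "finite H" "lo \<in> H"
    using wedge_lo[OF w(1)] lo_le_hi finite_subset by (auto simp: H_def)
  define h where "h = Max H"
  have "h \<in> H" unfolding h_def using H by (intro Max_in) auto
  then have h: "lo \<le> h" "h \<le> hi" "0 \<le> wedge (v h) w" by (auto simp: H_def)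
  show thesis
  proof (cases "h = hi")
    case True
    then have "0 \<le> wedge w (v h)" using wedge_hi w by simp
    with consecutive_irreds_span[OF irred_gen irred_gen _ w(1) h(3)] gens_between[of h h] h
    obtain a b :: nat where ab: "fst w = a * fst (v h) + b * fst (v h)"
      "snd w = a * snd (v h) + b * snd (v h)" by blast
    have "a + b \<noteq> 0"
    proof
      assume "a + b = 0"
      then have "w = 0" using ab by (auto simp: prod_eq_iff)
      with w show False by simp
    qed
    then have "normal_rep h (a + b) 0 w" using ab h by (simp add: normal_rep_def algebra_simps)
    then show thesis by (rule that)
  next
    case False
    then have h1: "lo \<le> h + 1" "h + 1 \<le> hi" using h by auto
    have "h + 1 \<notin> H" using Max_ge[OF H(1), of "h + 1"] by (auto simp: h_def)
    then have less: "0 < wedge w (v (h + 1))" using h1 wedge_flip[of w "v (h + 1)"]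
      by (auto simp: H_def)
    then obtain a b :: nat where ab: "fst w = a * fst (v h) + b * fst (v (h + 1))"
      "snd w = a * snd (v h) + b * snd (v (h + 1))"
      using consecutive_irreds_span[OF irred_gen[OF h(1,2)] irred_gen[OF h1] gens_between[OF h(1,2)]
          w(1) h(3)] h1 by fastforce
    have "a \<noteq> 0"
    proof
      assume "a = 0"
      then have "wedge w (v (h + 1)) = 0" using ab by (simp add: wedge_def)
      with less show False by simp
    qed
    then have "normal_rep h a b w" using ab h h1 by (simp add: normal_rep_def)
    then show thesis by (rule that)
  qed
qed

lemma normal_rep_bounds:
  assumes "normal_rep h a b w"
  shows "0 \<le> wedge (v h) w" "0 < b \<Longrightarrow> 0 < wedge (v h) w"
    "h + 1 \<le> hi \<Longrightarrow> 0 < wedge w (v (h + 1))"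
proof -
  have h: "lo \<le> h" "h \<le> hi" "0 < a" "0 < b \<longrightarrow> h + 1 \<le> hi"
    using assms by (auto simp: normal_rep_def)
  have eq: "wedge (v h) w = b * wedge (v h) (v (h + 1))"
    using normal_rep_wedge_right[OF assms, of "v h"] by simp
  show 2: "0 < wedge (v h) w" if "0 < b"
    using that h wedge_gens[of h "h + 1"] unfolding eq by simp
  show "0 \<le> wedge (v h) w" using 2 eq by (cases "b = 0") auto
  show "0 < wedge w (v (h + 1))" if "h + 1 \<le> hi"
    using normal_rep_wedge_left[OF assms, of "v (h + 1)"] that h wedge_gens[of h "h + 1"] by simp
qed

lemma normal_rep_pos:
  assumes "normal_rep h a b w"
  shows "0 < snd w"
proof -
  have h: "lo \<le> h" "h \<le> hi" "0 < a" "0 < b \<longrightarrow> h + 1 \<le> hi"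
    using assms by (auto simp: normal_rep_def)
  have "0 < a * snd (v h)" using gen_snd_pos h by simp
  moreover have "0 \<le> b * snd (v (h + 1))"
    using gen_snd_pos[of "h + 1"] h by (cases "b = 0") (auto intro!: mult_nonneg_nonneg less_imp_le)
  ultimately show ?thesis using assms by (simp add: normal_rep_def)
qed

text \<open>A point with normal form at \<open>h\<close> is strictly below \<open>v (h + 1)\<close>,
  and one with normal form at \<open>h'\<close> is not below \<open>v h'\<close>. For
  \<open>h + 1 \<le> h'\<close> the two contradict each other.\<close>

lemma normal_rep_index_le:
  assumes 1: "normal_rep h a b w" and 2: "normal_rep h' a' b' w"
  shows "h' \<le> h"
proof (rule ccontr)
  assume "\<not> ?thesis"
  then have h: "lo \<le> h" "h + 1 \<le> h'" "h' \<le> hi" using 1 2 by (auto simp: normal_rep_def)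
  have "0 < wedge w (v (h + 1))" using normal_rep_bounds(3)[OF 1] h by simp
  moreover have "0 \<le> wedge (v (h + 1)) w"
  proof (cases "h + 1 = h'")
    case True then show ?thesis using normal_rep_bounds(1)[OF 2] by simp
  next
    case False
    show ?thesis
      by (rule wedge_trans[of _ "v h'"])
        (use False h wedge_gens[of "h + 1" h'] normal_rep_bounds(1)[OF 2] gen_snd_pos[of "h + 1"]
          gen_snd_pos[of h'] normal_rep_pos[OF 1] in simp_all)
  qed
  ultimately show False using wedge_flip[of w "v (h + 1)"] by simp
qed

lemma normal_rep_unique:
  assumes 1: "normal_rep h a b w" and 2: "normal_rep h' a' b' w"
  shows "h = h'" "a = a'" "b = b'"
proof -
  show h: "h = h'" using normal_rep_index_le[OF 1 2] normal_rep_index_le[OF 2 1] by simp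
  have r: "lo \<le> h" "h \<le> hi" "0 < b \<or> 0 < b' \<longrightarrow> h + 1 \<le> hi"
    using 1 2 h by (auto simp: normal_rep_def)
  have "b * wedge (v h) (v (h + 1)) = b' * wedge (v h) (v (h + 1))"
    using normal_rep_wedge_right[OF 1, of "v h"] normal_rep_wedge_right[OF 2, of "v h"] h by simp
  then show b: "b = b'" using r wedge_gens[of h "h + 1"] by (cases "b = 0 \<and> b' = 0") auto
  have "a * snd (v h) = a' * snd (v h)" using 1 2 h b by (simp add: normal_rep_def)
  then show "a = a'" using gen_snd_pos[of h] r by simp
qed

text \<open>Here \<open>i + 2 \<le> j\<close> enters: another generator lies strictly between
  \<open>v i\<close> and \<open>v j\<close>, and pairing the equation with such a generator by
  \<open>wedge\<close> excludes the endpoints from the normal form of the sum.\<close>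

lemma normal_rep_gen_add:
  assumes ij: "lo \<le> i" "i + 2 \<le> j" "j \<le> hi" and n: "normal_rep h a b (v i + v j)"
  shows "i < h" "b = 0 \<Longrightarrow> h < j" "b = 0 \<Longrightarrow> 2 \<le> a" "0 < b \<Longrightarrow> h + 1 < j"
proof -
  let ?w = "v i + v j"
  have h: "lo \<le> h" "h \<le> hi" "0 < a" "0 < b \<longrightarrow> h + 1 \<le> hi"
    using n by (auto simp: normal_rep_def)
  have pos: "0 < snd (v i)" "0 < snd (v j)" "0 < snd (v h)" "0 < snd ?w"
    using gen_snd_pos[of i] gen_snd_pos[of j] gen_snd_pos[of h] ij h(1,2) by simp_all
  have wij: "0 < wedge (v i) (v j)" using wedge_gens ij by simp
  have iw: "0 < wedge (v i) ?w" and wj: "0 < wedge ?w (v j)"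
    using wij by (simp_all add: wedge_add_left wedge_add_right)
  have hw: "0 \<le> wedge (v h) ?w" using normal_rep_bounds(1)[OF n] .
  have hj: "h < j"
  proof (rule ccontr)
    assume "\<not> ?thesis"
    then have "0 \<le> wedge (v j) (v h)" using wedge_gens[of j h] ij h by (cases "h = j") auto
    then have "0 \<le> wedge (v j) ?w" by (rule wedge_trans[OF _ hw]) (use pos in simp_all)
    then show False using wj wedge_flip[of ?w "v j"] by simp
  qed
  have ih: "i \<le> h"
  proof (rule ccontr)
    assume "\<not> ?thesis"
    then have hi: "h + 1 \<le> i" by simp
    then have "0 \<le> wedge (v (h + 1)) (v i)"
      using wedge_gens[of "h + 1" i] ij h by (cases "h + 1 = i") auto
    then have "0 \<le> wedge (v (h + 1)) ?w"
      by (rule wedge_trans) (use iw pos gen_snd_pos[of "h + 1"] hi ij h in simp_all)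
    then show False
      using normal_rep_bounds(3)[OF n] hi ij wedge_flip[of ?w "v (h + 1)"] by simp
  qed
  show ih: "i < h"
  proof (rule ccontr)
    assume "\<not> ?thesis"
    with ih have [simp]: "h = i" by simp
    let ?k = "wedge (v i) (v (i + 1))"
    have k: "0 < ?k" "0 < wedge (v (i + 1)) (v j)" using ij wedge_gens by simp_all
    \<comment> \<open>Pairing with \<open>v (i + 1)\<close> removes the \<open>b\<close> term. As
      \<open>a\<close> is positive, the outcome would place \<open>v j\<close> not above
      \<open>v (i + 1)\<close>.\<close>
    have "wedge (v (i + 1)) (v i) + wedge (v (i + 1)) (v j) = a * wedge (v (i + 1)) (v i)"
      using normal_rep_wedge_right[OF n, of "v (i + 1)"] by (simp add: wedge_add_right)
    then have "wedge (v (i + 1)) (v j) = (1 - int a) * ?k"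
      using wedge_flip[of "v (i + 1)" "v i"] by (simp add: algebra_simps)
    moreover have "(1 - int a) * ?k \<le> 0" using h k by (intro mult_nonpos_nonneg) auto
    ultimately show False using k by simp
  qed
  show "h < j" by fact
  show "h + 1 < j" if b: "0 < b"
  proof (rule ccontr)
    assume "\<not> ?thesis"
    with hj have [simp]: "j = h + 1" by simp
    let ?k = "wedge (v h) (v j)"
    have k: "0 < ?k" "0 < wedge (v i) (v h)" using ij ih wedge_gens by simp_all
    have "wedge (v i) (v h) + wedge (v j) (v h) = b * wedge (v j) (v h)"
      using normal_rep_wedge_left[OF n, of "v h"] by (simp add: wedge_add_left)
    then have "wedge (v i) (v h) = (1 - int b) * ?k"
      using wedge_flip[of "v j" "v h"] by (simp add: algebra_simps)
    moreover have "(1 - int b) * ?k \<le> 0" using b k by (intro mult_nonpos_nonneg) auto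
    ultimately show False using k by simp
  qed
  \<comment> \<open>The exponent \<open>1\<close> would exhibit the irreducible point
    \<open>v h\<close> as a sum of two nonzero points.\<close>
  show "2 \<le> a" if b: "b = 0"
  proof (rule ccontr)
    assume "\<not> ?thesis"
    with h have "a = 1" by simp
    then have "v h = v i + v j" using n b by (simp add: normal_rep_def prod_eq_iff)
    moreover have "v i \<in> M" "v i \<noteq> 0" "v j \<in> M" "v j \<noteq> 0"
      using gen_mem gen_nonzero ij by simp_all
    ultimately show False using irred_gen[OF h(1,2)] unfolding irred_def by blast
  qed
qed

end

subsection \<open>Best approximations\<close>

text \<open>The bounds on \<open>c / d\<close> are multiplied by \<open>d\<close> so that the origin
  is included; for \<open>d = 0\<close> they force \<open>c = 0\<close>.\<close>

definition cone_points :: "rat \<Rightarrow> rat \<Rightarrow> (int \<times> int) set" where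
  "cone_points \<alpha> \<beta> = {w. 0 \<le> snd w \<and> - \<beta> * of_int (snd w) \<le> of_int (fst w) \<and>
     of_int (fst w) \<le> \<alpha> * of_int (snd w)}"

lemma saturated_cone_points: "saturated_monoid (cone_points \<alpha> \<beta>)"
proof
  show "0 \<in> cone_points \<alpha> \<beta>" by (simp add: cone_points_def)
  show "0 < snd w" if "w \<in> cone_points \<alpha> \<beta>" "w \<noteq> 0" for w
  proof (rule ccontr)
    assume "\<not> ?thesis"
    then have "snd w = 0" using that by (simp add: cone_points_def)
    then have "w = 0" using that by (auto simp: cone_points_def prod_eq_iff)
    with that show False by simp
  qed
  fix a b z :: "int \<times> int" and p q k :: int
  assume a: "a \<in> cone_points \<alpha> \<beta>" and b: "b \<in> cone_points \<alpha> \<beta>"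
    and pq: "0 \<le> p" "0 \<le> q" and k: "0 < k"
    and z: "k * fst z = p * fst a + q * fst b" "k * snd z = p * snd a + q * snd b"
  have kr: "(0::rat) < of_int k" using k by simp
  have "0 \<le> k * snd z" using a b pq unfolding z cone_points_def by simp
  then have z0: "0 \<le> snd z" using k by (simp add: zero_le_mult_iff)
  have "of_int k * (- \<beta> * of_int (snd z)) = - \<beta> * of_int (k * snd z)" by simp
  also have "\<dots> = of_int p * (- \<beta> * of_int (snd a)) + of_int q * (- \<beta> * of_int (snd b))"
    unfolding z by (simp add: algebra_simps)
  also have "\<dots> \<le> of_int p * of_int (fst a) + of_int q * of_int (fst b)"
    using a b pq by (intro add_mono mult_left_mono) (auto simp: cone_points_def)
  also have "\<dots> = of_int (k * fst z)" unfolding z by simp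
  also have "\<dots> = of_int k * of_int (fst z)" by simp
  finally have 1: "- \<beta> * of_int (snd z) \<le> of_int (fst z)"
    using mult_le_cancel_left_pos[OF kr] by blast
  have "of_int k * of_int (fst z) = (of_int (k * fst z) :: rat)" by simp
  also have "\<dots> = of_int p * of_int (fst a) + of_int q * of_int (fst b)" unfolding z by simp
  also have "\<dots> \<le> of_int p * (\<alpha> * of_int (snd a)) + of_int q * (\<alpha> * of_int (snd b))"
    using a b pq by (intro add_mono mult_left_mono) (auto simp: cone_points_def)
  also have "\<dots> = \<alpha> * of_int (k * snd z)" unfolding z by (simp add: algebra_simps)
  also have "\<dots> = of_int k * (\<alpha> * of_int (snd z))" by simp
  finally have "of_int (fst z) \<le> \<alpha> * of_int (snd z)"
    using mult_le_cancel_left_pos[OF kr] by blast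
  with 1 z0 show "z \<in> cone_points \<alpha> \<beta>" by (simp add: cone_points_def)
qed

interpretation cone: saturated_monoid "cone_points \<alpha> \<beta>" for \<alpha> \<beta>
  by (rule saturated_cone_points)

lemma cone_points_nat_iff:
  "0 < n \<Longrightarrow> (c, int n) \<in> cone_points \<alpha> \<beta> \<longleftrightarrow> of_int c / of_nat n \<in> {- \<beta>..\<alpha>}"
  by (simp add: cone_points_def field_simps)

lemma slope_le_iff:
  assumes "0 < m" "0 < n"
  shows "(of_int c / of_nat m :: rat) \<le> of_int d / of_nat n \<longleftrightarrow> 0 \<le> wedge (c, int m) (d, int n)"
proof -
  have "(of_int c / of_nat m :: rat) \<le> of_int d / of_nat n \<longleftrightarrow>
      of_int (c * int n) \<le> (of_int (d * int m) :: rat)"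
    using assms by (simp add: divide_simps mult.commute)
  also have "\<dots> \<longleftrightarrow> c * int n \<le> d * int m" by (rule of_int_le_iff)
  finally show ?thesis by (simp add: wedge_def mult.commute)
qed

lemma slope_less_iff:
  assumes "0 < m" "0 < n"
  shows "(of_int c / of_nat m :: rat) < of_int d / of_nat n \<longleftrightarrow> 0 < wedge (c, int m) (d, int n)"
  using slope_le_iff[OF assms(2,1), of d c] wedge_flip[of "(c, int m)" "(d, int n)"]
  by (auto simp: not_le[symmetric] simp del: not_le)

text \<open>In a proper decomposition the summand of larger slope would have its slope between
  \<open>c / d\<close> and \<alpha> and a smaller denominator, contradicting bestness.\<close>

lemma best_lower_approx_irred:
  assumes best: "best_lower_approx \<alpha> c d" and lo: "- \<beta> \<le> of_int c / of_nat d"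
  shows "cone.irred \<alpha> \<beta> (c, int d)"
proof -
  let ?M = "cone_points \<alpha> \<beta>"
  have d: "0 < d" "of_int c / of_nat d \<le> \<alpha>" using best by (auto simp: best_lower_approx_def)
  have step: False
    if ab: "a \<in> ?M" "b \<in> ?M" "a \<noteq> 0" "b \<noteq> 0" "(c, int d) = a + b" "0 \<le> wedge a b" for a b
  proof -
    have pos: "0 < snd a" "0 < snd b" using ab cone.snd_pos by blast+
    have "snd a + snd b = int d" using ab(5) by (metis snd_add snd_conv)
    then have less: "nat (snd b) < d" using pos by linarith
    have "0 \<le> wedge (c, int d) b" unfolding ab(5) using ab(6) by (simp add: wedge_add_left)
    then have "of_int c / of_nat d \<le> (of_int (fst b) / of_nat (nat (snd b)) :: rat)"
      using slope_le_iff[of d "nat (snd b)" c "fst b"] d pos by simp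
    moreover have "of_int (fst b) / of_nat (nat (snd b)) \<le> \<alpha>"
      using cone_points_nat_iff[of "nat (snd b)" "fst b" \<alpha> \<beta>] ab pos by simp
    moreover have "0 < nat (snd b)" using pos by simp
    ultimately show False using best less unfolding best_lower_approx_def by blast
  qed
  have "a = 0 \<or> b = 0" if "a \<in> ?M" "b \<in> ?M" "(c, int d) = a + b" for a b
  proof (rule ccontr)
    assume "\<not> ?thesis"
    then show False using step[of a b] step[of b a] that wedge_flip[of a b]
      by (cases "0 \<le> wedge a b") (auto simp: add.commute)
  qed
  moreover have "(c, int d) \<in> ?M" using cone_points_nat_iff d lo by simp
  ultimately show ?thesis using d by (auto simp: cone.irred_def prod_eq_iff)
qed

text \<open>A fraction \<open>y\<close> violating bestness would make \<open>z + y - w\<close> a point of the cone whose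
  denominator is below the minimal one, that of \<open>z\<close>.\<close>

lemma irred_best_lower_approx:
  assumes w: "cone.irred \<alpha> \<beta> w" and z: "z \<in> cone_points \<alpha> \<beta>" "0 < snd z"
    and min: "\<And>u. u \<in> cone_points \<alpha> \<beta> \<Longrightarrow> u \<noteq> 0 \<Longrightarrow> snd z \<le> snd u"
    and less: "0 < wedge z w"
  shows "best_lower_approx \<alpha> (fst w) (nat (snd w))"
proof -
  let ?M = "cone_points \<alpha> \<beta>"
  have wM: "w \<in> ?M" "w \<noteq> 0" using w by (auto simp: cone.irred_def)
  then have wpos: "0 < snd w" by (rule cone.snd_pos)
  have wr: "of_int (fst w) / of_nat (nat (snd w)) \<in> {- \<beta>..\<alpha>}"
    using cone_points_nat_iff[of "nat (snd w)" "fst w" \<alpha> \<beta>] wM wpos by simp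
  have False if y: "0 < n" "of_int (fst w) / of_nat (nat (snd w)) \<le> (of_int m / of_nat n :: rat)"
      "of_int m / of_nat n \<le> \<alpha>" "n < nat (snd w)" for m n
  proof -
    define y where "y = (m, int n)"
    have yM: "y \<in> ?M" using cone_points_nat_iff[of n m \<alpha> \<beta>] y wr by (auto simp: y_def)
    have wy: "0 \<le> wedge w y"
      using slope_le_iff[of "nat (snd w)" n "fst w" m] y wpos by (simp add: y_def)
    have ny: "0 < snd y" "snd y < snd w" using y by (auto simp: y_def)
    have zy: "0 < wedge z y"
      by (rule wedge_less_trans1[OF less wy]) (use z wpos ny in auto)
    \<comment> \<open>On a common ray \<open>y\<close> could be subtracted from \<open>w\<close>,
      because \<open>w - y\<close> is then \<open>w\<close> scaled by a positive fraction.\<close>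
    have "wedge w y \<noteq> 0"
    proof
      assume 0: "wedge w y = 0"
      have "w - y \<in> ?M"
      proof (rule cone.saturated[OF wM(1) cone.zero_mem])
        show "snd w * fst (w - y) = (snd w - snd y) * fst w + 0 * fst (0::int \<times> int)"
          using 0 by (simp add: wedge_def algebra_simps)
      qed (use ny in \<open>auto simp: algebra_simps\<close>)
      then show False using cone.irredD[OF w yM] ny by auto
    qed
    with wy have wy: "0 < wedge w y" by simp
    have "z + y - w \<in> ?M" using cone.add_diff_irred_mem(1)[OF w z(1) yM less wy] .
    moreover have "z + y - w \<noteq> 0"
    proof
      assume "z + y - w = 0"
      then have "w = z + y" by simp
      moreover have "z \<noteq> 0" "y \<noteq> 0" using z(2) ny by auto
      ultimately show False using w z(1) yM unfolding cone.irred_def by blast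
    qed
    ultimately have "snd z \<le> snd (z + y - w)" by (rule min)
    then show False using ny by simp
  qed
  moreover have "0 < nat (snd w)" "of_int (fst w) / of_nat (nat (snd w)) \<le> \<alpha>"
    using wr wpos by simp_all
  ultimately show ?thesis unfolding best_lower_approx_def by blast
qed

text \<open>Reversing slopes turns best upper approximations of - \<beta> into best lower
  approximations of \<beta>, so that the results above also cover the points below
  \<open>c 0 / d 0\<close>.\<close>

definition reflect :: "int \<times> int \<Rightarrow> int \<times> int" where
  "reflect w = (- fst w, snd w)"

lemma reflect_simps [simp]:
  "fst (reflect w) = - fst w" "snd (reflect w) = snd w" "reflect (reflect w) = w"
  "reflect w = 0 \<longleftrightarrow> w = 0" "wedge (reflect u) (reflect w) = wedge w u"
  "reflect w \<in> cone_points \<beta> \<alpha> \<longleftrightarrow> w \<in> cone_points \<alpha> \<beta>"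
  by (auto simp: reflect_def prod_eq_iff wedge_def cone_points_def)

lemma reflect_add: "reflect (a + b) = reflect a + reflect b"
  by (simp add: prod_eq_iff)

lemma irred_reflect: "cone.irred \<alpha> \<beta> w \<Longrightarrow> cone.irred \<beta> \<alpha> (reflect w)"
  unfolding cone.irred_def by (metis reflect_add reflect_simps(3,4,6))

text \<open>An irreducible point lies above, below or on the ray of \<open>v 0\<close>. Above, it is
  a best lower approximation of \<alpha>; below, its reflection is one of \<beta>; on the ray it is
  \<open>v 0\<close> itself. Since the extreme slopes are \<alpha> and - \<beta>, the first and last
  generators bound the cone.\<close>

lemma best_approximations_hilbert_basis:
  fixes c :: "int \<Rightarrow> int" and d :: "int \<Rightarrow> nat" and r s :: nat and \<alpha> \<beta> :: rat
  defines "q \<equiv> \<lambda>i. of_int (c i) / of_nat (d i) :: rat" and "v \<equiv> \<lambda>i. (c i, int (d i))"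
  assumes d0: "0 < d 0" and q0: "q 0 \<in> {- \<beta> .. \<alpha>}"
    and min: "\<And>m n. 0 < n \<Longrightarrow> of_int m / of_nat n \<in> {- \<beta> .. \<alpha>} \<Longrightarrow> d 0 \<le> n"
    and mono: "strict_mono_on {- int s .. int r} q"
    and lower: "{(c i, d i) |i. 0 < i \<and> i \<le> int r} =
         {(m, n). best_lower_approx \<alpha> m n \<and> q 0 < of_int m / of_nat n}"
    and q_r: "q (int r) = \<alpha>"
    and upper: "{(c i, d i) |i. - int s \<le> i \<and> i < 0} =
         {(m, n). best_upper_approx (- \<beta>) m n \<and> of_int m / of_nat n < q 0}"
    and q_s: "q (- int s) = - \<beta>"
  shows "hilbert_basis (cone_points \<alpha> \<beta>) v (- int s) (int r)"
proof -
  let ?M = "cone_points \<alpha> \<beta>"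
  have best_lower: "best_lower_approx \<alpha> (c i) (d i)" "q 0 < q i" if "0 < i" "i \<le> int r" for i
  proof -
    have "(c i, d i) \<in> {(c i, d i) |i. 0 < i \<and> i \<le> int r}" using that by blast
    then show "best_lower_approx \<alpha> (c i) (d i)" "q 0 < q i" unfolding lower by (auto simp: q_def)
  qed
  have best_upper: "best_lower_approx \<beta> (- c i) (d i)" "q i < q 0" if "- int s \<le> i" "i < 0" for i
  proof -
    have "(c i, d i) \<in> {(c i, d i) |i. - int s \<le> i \<and> i < 0}" using that by blast
    then show "best_lower_approx \<beta> (- c i) (d i)" "q i < q 0"
      unfolding upper by (auto simp: q_def best_upper_approx_def)
  qed
  have d_pos: "0 < d i" if "- int s \<le> i" "i \<le> int r" for i
    using that d0 best_lower(1)[of i] best_upper(1)[of i]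
    by (cases i "0 :: int" rule: linorder_cases) (auto simp: best_lower_approx_def)
  have v0: "v 0 \<in> ?M" "0 < snd (v 0)"
    using cone_points_nat_iff[OF d0, of "c 0" \<alpha> \<beta>] q0 d0 by (simp_all add: v_def q_def)
  have min': "snd (v 0) \<le> snd u" if u: "u \<in> ?M" "u \<noteq> 0" for u
  proof -
    have "0 < snd u" using cone.snd_pos u .
    moreover from this have "d 0 \<le> nat (snd u)"
      using cone_points_nat_iff[of "nat (snd u)" "fst u" \<alpha> \<beta>] u
      by (intro min[of _ "fst u"]) simp_all
    ultimately show ?thesis by (simp add: v_def)
  qed
  have irred0: "cone.irred \<alpha> \<beta> (v 0)"
    unfolding cone.irred_def
  proof (intro conjI ballI impI)
    show "v 0 \<in> ?M" by fact
    show "v 0 \<noteq> 0" using v0 by auto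
    fix a b assume ab: "a \<in> ?M" "b \<in> ?M" "v 0 = a + b"
    \<comment> \<open>Two nonzero summands would each have denominator at least \<open>d 0\<close>,
      so the sum would have at least twice that.\<close>
    have "snd (v 0) = snd a + snd b" by (simp add: ab(3))
    then show "a = 0 \<or> b = 0" using min'[of a] min'[of b] ab(1,2) v0(2) by linarith
  qed
  have irred_lower: "cone.irred \<alpha> \<beta> (v i)" if i: "0 < i" "i \<le> int r" for i
    unfolding v_def
    using best_lower[OF i] q0 by (intro best_lower_approx_irred) (auto simp: q_def)
  have irred_upper: "cone.irred \<alpha> \<beta> (v i)" if i: "- int s \<le> i" "i < 0" for i
  proof -
    have "cone.irred \<beta> \<alpha> (- c i, int (d i))"
      using best_upper[OF i] q0 by (intro best_lower_approx_irred) (auto simp: q_def)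
    from irred_reflect[OF this] show ?thesis by (simp add: v_def reflect_def)
  qed
  have irred_gen: "cone.irred \<alpha> \<beta> (v i)" if "- int s \<le> i" "i \<le> int r" for i
    using that irred0 irred_lower[of i] irred_upper[of i]
    by (cases i "0 :: int" rule: linorder_cases) auto
  have gen_irred: "\<exists>i\<in>{- int s .. int r}. w = v i" if w: "cone.irred \<alpha> \<beta> w" for w
  proof -
    have wM: "w \<in> ?M" "w \<noteq> 0" using w by (auto simp: cone.irred_def)
    have wpos: "0 < snd w" using cone.snd_pos wM .
    consider "0 < wedge (v 0) w" | "wedge (v 0) w < 0" | "wedge (v 0) w = 0" by linarith
    then show ?thesis
    proof cases
      case 1
      have "best_lower_approx \<alpha> (fst w) (nat (snd w))"
        by (rule irred_best_lower_approx[OF w v0 min' 1])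
      moreover have "q 0 < of_int (fst w) / of_nat (nat (snd w))"
        using slope_less_iff[of "d 0" "nat (snd w)" "c 0" "fst w"] 1 d0 wpos
        by (simp add: q_def v_def)
      ultimately have "(fst w, nat (snd w)) \<in> {(c i, d i) |i. 0 < i \<and> i \<le> int r}"
        unfolding lower by simp
      then obtain i where i: "0 < i" "i \<le> int r" "fst w = c i" "nat (snd w) = d i" by auto
      then have "w = v i" using wpos by (auto simp: v_def prod_eq_iff)
      then show ?thesis using i by force
    next
      case 2
      have "best_lower_approx \<beta> (fst (reflect w)) (nat (snd (reflect w)))"
        by (rule irred_best_lower_approx[OF irred_reflect[OF w], of "reflect (v 0)"])
          (use v0 min' 2 wedge_flip[of w "v 0"] in \<open>auto dest: min'[of "reflect _", simplified]\<close>)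
      moreover have "of_int (fst w) / of_nat (nat (snd w)) < q 0"
        using slope_less_iff[of "nat (snd w)" "d 0" "fst w" "c 0"] 2 d0 wpos
          wedge_flip[of w "v 0"] by (simp add: q_def v_def)
      ultimately have "(fst w, nat (snd w)) \<in> {(c i, d i) |i. - int s \<le> i \<and> i < 0}"
        unfolding upper best_upper_approx_def by simp
      then obtain i where i: "- int s \<le> i" "i < 0" "fst w = c i" "nat (snd w) = d i" by auto
      then have "w = v i" using wpos by (auto simp: v_def prod_eq_iff)
      then show ?thesis using i by force
    next
      case 3
      \<comment> \<open>The denominator of \<open>v 0\<close> is minimal, so subtracting
        \<open>v 0\<close> from \<open>w\<close> stays on their common ray.\<close>
      have "w - v 0 \<in> ?M"
      proof (rule cone.saturated[OF wM(1) cone.zero_mem])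
        show "snd w * fst (w - v 0) = (snd w - snd (v 0)) * fst w + 0 * fst (0 :: int \<times> int)"
          using 3 by (simp add: wedge_def algebra_simps)
      qed (use wpos min'[OF wM] in \<open>auto simp: algebra_simps\<close>)
      then have "w = v 0" using cone.irredD[OF w v0(1)] v0(2) by auto
      then show ?thesis by force
    qed
  qed
  have wedge_q: "0 < wedge (v i) (v j) \<longleftrightarrow> q i < q j"
    if "- int s \<le> i" "i \<le> int r" "- int s \<le> j" "j \<le> int r" for i j
    using slope_less_iff[OF d_pos d_pos, OF that, of "c i" "c j"] by (simp add: q_def v_def)
  show ?thesis
  proof
    show "- int s \<le> int r" by simp
    show "cone.irred \<alpha> \<beta> w \<longleftrightarrow> (\<exists>i\<in>{- int s..int r}. w = v i)" for w
      using irred_gen gen_irred by (metis atLeastAtMost_iff)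
    show "0 < wedge (v i) (v j)" if "- int s \<le> i" "i < j" "j \<le> int r" for i j
      using that wedge_q[of i j] strict_mono_onD[OF mono, of i j] by simp
    fix w assume w: "w \<in> ?M"
    have pos: "0 < d (- int s)" "0 < d (int r)" using d_pos by simp_all
    have slope: "of_int (fst w) / of_nat (nat (snd w)) \<in> {- \<beta>..\<alpha>}" "0 < nat (snd w)" if "w \<noteq> 0"
      using that cone.snd_pos[OF w] cone_points_nat_iff[of "nat (snd w)" "fst w" \<alpha> \<beta>] w by simp_all
    show "0 \<le> wedge (v (- int s)) w"
      using slope slope_le_iff[OF pos(1) slope(2), of "c (- int s)" "fst w"] q_s
      by (cases "w = 0") (auto simp: q_def v_def)
    show "0 \<le> wedge w (v (int r))"
      using slope slope_le_iff[OF slope(2) pos(2), of "fst w" "c (int r)"] q_r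
      by (cases "w = 0") (auto simp: q_def v_def)
  qed
qed

subsection \<open>Monoid algebras\<close>

abbreviation subring_of :: "'r::comm_ring_1 set \<Rightarrow> 'r ring" where
  "subring_of C \<equiv> \<lparr>carrier = C, monoid.mult = (*), one = 1, zero = 0, add = (+)\<rparr>"

text \<open>The canonical ring and the polynomial ring are records whose carriers are subsets of
  types that already have ring operations. Closure under these operations yields the ring axioms of
  the record and lets ideals and generated subrings be handled by the class operations.\<close>

locale class_subring =
  fixes C :: "'r::comm_ring_1 set"
  assumes one_mem: "1 \<in> C" and uminus_mem: "x \<in> C \<Longrightarrow> - x \<in> C"
    and add_mem: "x \<in> C \<Longrightarrow> y \<in> C \<Longrightarrow> x + y \<in> C" and mult_mem: "x \<in> C \<Longrightarrow> y \<in> C \<Longrightarrow> x * y \<in> C"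
begin

lemma zero_mem: "0 \<in> C"
  using add_mem[OF one_mem uminus_mem[OF one_mem]] by simp

lemma cring: "cring (subring_of C)"
proof (rule cringI)
  show "abelian_group (subring_of C)"
  proof (rule abelian_groupI)
    show "\<exists>y\<in>carrier (subring_of C). y \<oplus>\<^bsub>subring_of C\<^esub> x = \<zero>\<^bsub>subring_of C\<^esub>"
      if "x \<in> carrier (subring_of C)" for x
      using that uminus_mem by (intro bexI[of _ "- x"]) auto
  qed (use zero_mem add_mem in \<open>auto simp: algebra_simps\<close>)
  show "comm_monoid (subring_of C)"
    by (rule comm_monoidI) (use one_mem mult_mem in \<open>auto simp: algebra_simps\<close>)
qed (auto simp: algebra_simps)

sublocale ring: cring "subring_of C"
  by (rule cring)

lemma a_inv_eq: "x \<in> C \<Longrightarrow> \<ominus>\<^bsub>subring_of C\<^esub> x = - x"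
  using ring.minus_equality[of "- x" x] uminus_mem by simp

lemma ideal_subring_of:
  assumes "J \<subseteq> C" "0 \<in> J" "\<And>x y. x \<in> J \<Longrightarrow> y \<in> J \<Longrightarrow> x + y \<in> J"
    and mult: "\<And>x y. x \<in> C \<Longrightarrow> y \<in> J \<Longrightarrow> x * y \<in> J"
  shows "ideal J (subring_of C)"
proof (rule idealI)
  have "- x \<in> J" if "x \<in> J" for x
    using mult[OF uminus_mem[OF one_mem] that] by simp
  then show "subgroup J (add_monoid (subring_of C))"
    using assms by (intro ring.add.subgroupI) (auto simp: a_inv_def[symmetric] a_inv_eq subset_iff)
  show "a \<otimes>\<^bsub>subring_of C\<^esub> x \<in> J" if "a \<in> J" "x \<in> carrier (subring_of C)" for a x
    using mult[of x a] that by (simp add: mult.commute)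
qed (use mult in \<open>auto simp: ring.ring_axioms\<close>)

lemma idealD:
  assumes "ideal J (subring_of C)"
  shows "J \<subseteq> C" "0 \<in> J" "x \<in> J \<Longrightarrow> y \<in> J \<Longrightarrow> x + y \<in> J" "x \<in> C \<Longrightarrow> y \<in> J \<Longrightarrow> x * y \<in> J"
  using ideal.axioms(1)[OF assms] ideal.I_l_closed[OF assms]
    additive_subgroup.a_subset additive_subgroup.zero_closed additive_subgroup.a_closed
  by fastforce+

lemma generate_ring_subset:
  assumes "H \<subseteq> C'" "class_subring C'" "C' \<subseteq> C"
  shows "generate_ring (subring_of C) H \<subseteq> C'"
proof
  interpret C': class_subring C' by fact
  fix x assume "x \<in> generate_ring (subring_of C) H"
  then show "x \<in> C'"
    by induction (use assms C'.one_mem C'.add_mem C'.mult_mem C'.uminus_mem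
      in \<open>auto simp: a_inv_eq subset_iff\<close>)
qed

lemma class_subring_generate_ring:
  assumes "H \<subseteq> C"
  shows "class_subring (generate_ring (subring_of C) H)"
proof
  let ?G = "generate_ring (subring_of C) H"
  have sub: "?G \<subseteq> C" using ring.generate_ring_incl[of H] assms by simp
  show "1 \<in> ?G" using generate_ring.one[of "subring_of C" H] by simp
  show "- x \<in> ?G" if "x \<in> ?G" for x
    using generate_ring.a_inv[OF that] a_inv_eq[of x] that sub by auto
  show "x + y \<in> ?G" if "x \<in> ?G" "y \<in> ?G" for x y
    using generate_ring.eng_add[OF that] by simp
  show "x * y \<in> ?G" if "x \<in> ?G" "y \<in> ?G" for x y
    using generate_ring.eng_mult[OF that] by simp
qed

lemma sum_mem: "(\<And>a. a \<in> A \<Longrightarrow> f a \<in> C) \<Longrightarrow> sum f A \<in> C"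
  by (induction A rule: infinite_finite_induct) (auto intro: zero_mem add_mem)

lemma power_mem: "x \<in> C \<Longrightarrow> x ^ n \<in> C"
  by (induction n) (auto intro: one_mem mult_mem)

end

lemma sum_single_lookup:
  "(\<Sum>m\<in>Poly_Mapping.keys p. Poly_Mapping.single m (Poly_Mapping.lookup p m)) = p"
  by (rule poly_mapping_eqI) (auto simp: lookup_sum lookup_single when_def in_keys_iff)

text \<open>\<open>T\<close> is an exponential map on an additive monoid; together with the
  coefficient map it determines a homomorphism on the monoid algebra. This covers both the map from
  the algebra of lattice points and the evaluation of polynomials at the generators.\<close>

locale monoid_algebra_hom =
  fixes \<kappa> :: "'k::comm_ring_1 \<Rightarrow> 'r::comm_ring_1" and T :: "'m::comm_monoid_add \<Rightarrow> 'r"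
  assumes \<kappa>_zero: "\<kappa> 0 = 0" and \<kappa>_one: "\<kappa> 1 = 1"
    and \<kappa>_add: "\<kappa> (x + y) = \<kappa> x + \<kappa> y" and \<kappa>_mult: "\<kappa> (x * y) = \<kappa> x * \<kappa> y"
    and T_zero: "T 0 = 1" and T_add: "T (a + b) = T a * T b"
begin

definition lift :: "('m \<Rightarrow>\<^sub>0 'k) \<Rightarrow> 'r" where
  "lift p = (\<Sum>m\<in>Poly_Mapping.keys p. \<kappa> (Poly_Mapping.lookup p m) * T m)"

lemma lift_single [simp]: "lift (Poly_Mapping.single m x) = \<kappa> x * T m"
  by (simp add: lift_def \<kappa>_zero)

lemma lift_zero [simp]: "lift 0 = 0"
  by (simp add: lift_def)

lemma lift_one [simp]: "lift 1 = 1"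
  using lift_single[of 0 1] by (simp add: \<kappa>_one T_zero)

lemma lift_add: "lift (p + q) = lift p + lift q"
  unfolding lift_def
  by (rule setsum_keys_plus_distrib) (simp_all add: \<kappa>_zero \<kappa>_add distrib_right)

lemma lift_sum: "lift (sum p A) = (\<Sum>a\<in>A. lift (p a))"
  by (induction A rule: infinite_finite_induct) (auto simp: lift_add)

lemma lift_uminus: "lift (- p) = - lift p"
  using lift_add[of p "- p"] by (simp add: eq_neg_iff_add_eq_0 add.commute)

lemma lift_diff: "lift (p - q) = lift p - lift q"
  using lift_add[of p "- q"] by (simp add: lift_uminus)

lemma lift_mult: "lift (p * q) = lift p * lift q"
proof -
  let ?s = "\<lambda>p m. Poly_Mapping.single m (Poly_Mapping.lookup p m)"
  have "p * q = (\<Sum>m\<in>Poly_Mapping.keys p. ?s p m) * (\<Sum>n\<in>Poly_Mapping.keys q. ?s q n)"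
    by (simp only: sum_single_lookup)
  also have "\<dots> = (\<Sum>m\<in>Poly_Mapping.keys p. \<Sum>n\<in>Poly_Mapping.keys q. ?s p m * ?s q n)"
    by (simp add: sum_product)
  finally have "lift (p * q) =
      (\<Sum>m\<in>Poly_Mapping.keys p. \<Sum>n\<in>Poly_Mapping.keys q. lift (?s p m * ?s q n))"
    by (simp add: lift_sum)
  also have "\<dots> = lift p * lift q"
    by (simp add: lift_def[of p] lift_def[of q] sum_product mult_single \<kappa>_mult T_add mult_ac)
  finally show ?thesis .
qed

definition span :: "'m set \<Rightarrow> 'r set" where
  "span W = lift ` {p. Poly_Mapping.keys p \<subseteq> W}"

lemma class_subring_span:
  assumes W: "0 \<in> W" "\<And>a b. a \<in> W \<Longrightarrow> b \<in> W \<Longrightarrow> a + b \<in> W"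
  shows "class_subring (span W)"
proof
  let ?C = "{p :: 'm \<Rightarrow>\<^sub>0 'k. Poly_Mapping.keys p \<subseteq> W}"
  show "1 \<in> span W" unfolding span_def using W by (intro image_eqI[of _ _ 1]) auto
  show "- x \<in> span W" if x: "x \<in> span W" for x
  proof -
    from x obtain p where p: "p \<in> ?C" "x = lift p" by (auto simp: span_def)
    then have "- p \<in> ?C" by (auto simp: in_keys_iff)
    then show ?thesis using p by (auto simp: span_def lift_uminus[symmetric])
  qed
  fix x y assume "x \<in> span W" "y \<in> span W"
  then obtain p q where pq: "p \<in> ?C" "x = lift p" "q \<in> ?C" "y = lift q" by (auto simp: span_def)
  have "p + q \<in> ?C" using pq keys_add[of p q] by blast
  then show "x + y \<in> span W" using pq by (auto simp: span_def lift_add[symmetric])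
  have "p * q \<in> ?C" using pq keys_mult[of p q] W(2) by fastforce
  then show "x * y \<in> span W" using pq by (auto simp: span_def lift_mult[symmetric])
qed

lemma span_single: "m \<in> W \<Longrightarrow> \<kappa> x * T m \<in> span W"
  unfolding span_def by (rule image_eqI[of _ _ "Poly_Mapping.single m x"]) auto

lemma span_mono: "V \<subseteq> W \<Longrightarrow> span V \<subseteq> span W"
  by (auto simp: span_def)

lemma span_subset:
  assumes "class_subring C" "range \<kappa> \<subseteq> C" "T ` W \<subseteq> C"
  shows "span W \<subseteq> C"
proof
  interpret class_subring C by fact
  fix x assume "x \<in> span W"
  then obtain p where p: "Poly_Mapping.keys p \<subseteq> W" "x = lift p" by (auto simp: span_def)
  then show "x \<in> C"
    unfolding p lift_def using assms(2,3) by (intro sum_mem mult_mem) auto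
qed

end

lemma class_subring_keys:
  fixes W :: "'m::comm_monoid_add set"
  assumes W: "0 \<in> W" "\<And>a b. a \<in> W \<Longrightarrow> b \<in> W \<Longrightarrow> a + b \<in> W"
  shows "class_subring {p :: 'm \<Rightarrow>\<^sub>0 'k::comm_ring_1. Poly_Mapping.keys p \<subseteq> W}"
proof
  fix p q :: "'m \<Rightarrow>\<^sub>0 'k"
  assume pq: "p \<in> {p. Poly_Mapping.keys p \<subseteq> W}" "q \<in> {p. Poly_Mapping.keys p \<subseteq> W}"
  show "p + q \<in> {p. Poly_Mapping.keys p \<subseteq> W}" using pq keys_add[of p q] by blast
  show "p * q \<in> {p. Poly_Mapping.keys p \<subseteq> W}" using pq keys_mult[of p q] W(2) by fastforce
qed (use W in \<open>auto simp: in_keys_iff\<close>)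

subsection \<open>Toric relations\<close>

abbreviation mon :: "'m \<Rightarrow> 'm \<Rightarrow>\<^sub>0 'k::comm_ring_1" where
  "mon m \<equiv> Poly_Mapping.single m 1"

definition scale :: "nat \<Rightarrow> int \<times> nat \<Rightarrow> int \<times> nat" where
  "scale k w = (int k * fst w, k * snd w)"

lemma scale_simps [simp]: "scale 0 w = 0" "scale (Suc 0) w = w"
  and scale_add: "scale (k + l) w = scale k w + scale l w"
  by (simp_all add: scale_def prod_eq_iff algebra_simps)

text \<open>Degrees in \<open>u\<close> are natural numbers, while \<open>wedge\<close> and the
  exchange arguments need subtraction; \<open>emb\<close> passes to the full lattice.\<close>

definition emb :: "int \<times> nat \<Rightarrow> int \<times> int" where
  "emb w = (fst w, int (snd w))"

lemma emb_add: "emb (u + w) = emb u + emb w"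
  and emb_eq_iff: "emb u = emb w \<longleftrightarrow> u = w"
  and emb_zero [simp]: "emb 0 = 0"
  by (auto simp: emb_def prod_eq_iff)

text \<open>\<open>lift_inj\<close> expresses linear independence of the monomials
  \<open>T w\<close>. The ring is known here only through this property; everything else is the
  combinatorics of normal forms in \<open>M\<close>.\<close>

locale toric_presentation = hilbert_basis M v lo hi + monoid_algebra_hom \<kappa> T
  for M :: "(int \<times> int) set" and v :: "int \<Rightarrow> int \<times> int" and lo hi :: int
    and \<kappa> :: "'k::field \<Rightarrow> 'r::comm_ring_1" and T :: "int \<times> nat \<Rightarrow> 'r" +
  assumes lift_inj: "lift p = 0 \<Longrightarrow> p = 0"
begin

definition gen :: "int \<Rightarrow> int \<times> nat" where
  "gen i = (fst (v i), nat (snd (v i)))"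

text \<open>The grading by lattice points: evaluation sends the monomial with exponent vector
  \<open>m\<close> to \<open>T (val m)\<close>.\<close>

definition val :: "(int \<Rightarrow>\<^sub>0 nat) \<Rightarrow> int \<times> nat" where
  "val m = (\<Sum>i\<in>Poly_Mapping.keys m. scale (Poly_Mapping.lookup m i) (gen i))"

lemma emb_gen: "lo \<le> i \<Longrightarrow> i \<le> hi \<Longrightarrow> emb (gen i) = v i"
  using gen_snd_pos[of i] by (auto simp: emb_def gen_def prod_eq_iff)

lemma val_add: "val (m + n) = val m + val n"
  unfolding val_def by (rule setsum_keys_plus_distrib) (simp_all add: scale_add)

lemma val_zero [simp]: "val 0 = 0"
  by (simp add: val_def)

lemma val_single: "val (Poly_Mapping.single i k) = scale k (gen i)"
  by (simp add: val_def)

lemma T_scale: "T (scale k w) = T w ^ k"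
  by (induction k) (simp_all add: T_zero scale_add[of 1, simplified] T_add)

lemma T_sum: "T (sum f A) = (\<Prod>a\<in>A. T (f a))"
  by (induction A rule: infinite_finite_induct) (simp_all add: T_zero T_add)

lemma T_val: "T (val m) = (\<Prod>i\<in>Poly_Mapping.keys m. T (gen i) ^ Poly_Mapping.lookup m i)"
  by (simp add: val_def T_sum T_scale)

definition exponents :: "(int \<Rightarrow>\<^sub>0 nat) set" where
  "exponents = {m. Poly_Mapping.keys m \<subseteq> {lo..hi}}"

definition polys :: "((int \<Rightarrow>\<^sub>0 nat) \<Rightarrow>\<^sub>0 'k) set" where
  "polys = {p. Poly_Mapping.keys p \<subseteq> exponents}"

lemma exponents_zero: "0 \<in> exponents"
  by (simp add: exponents_def)

lemma exponents_add: "m \<in> exponents \<Longrightarrow> n \<in> exponents \<Longrightarrow> m + n \<in> exponents"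
  using keys_add[of m n] by (auto simp: exponents_def)

lemma exponents_single: "lo \<le> i \<Longrightarrow> i \<le> hi \<Longrightarrow> Poly_Mapping.single i k \<in> exponents"
  by (simp add: exponents_def)

sublocale polys: class_subring polys
  unfolding polys_def using exponents_zero exponents_add by (rule class_subring_keys)

lemma mon_mem_polys: "m \<in> exponents \<Longrightarrow> Poly_Mapping.single m x \<in> polys"
  by (simp add: polys_def)

sublocale ev: monoid_algebra_hom \<kappa> "\<lambda>m. T (val m)"
  by unfold_locales (simp_all add: \<kappa>_zero \<kappa>_one \<kappa>_add \<kappa>_mult T_zero T_add val_add)

text \<open>The monomials in at most two neighbouring variables of the index range, which represent
  all monomials modulo the relations. The vector \<open>0\<close> is listed separately because a
  normal form has \<open>0 < a\<close>.\<close>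

definition standard :: "(int \<Rightarrow>\<^sub>0 nat) \<Rightarrow> bool" where
  "standard m \<longleftrightarrow> m = 0 \<or> (\<exists>h a b. m = Poly_Mapping.single h a + Poly_Mapping.single (h + 1) b \<and>
     normal_rep h a b (emb (val m)))"

lemma emb_val_pair:
  assumes "lo \<le> h" "h \<le> hi" "0 < b \<longrightarrow> h + 1 \<le> hi"
  shows "fst (emb (val (Poly_Mapping.single h a + Poly_Mapping.single (h + 1) b))) =
      a * fst (v h) + b * fst (v (h + 1))"
    and "snd (emb (val (Poly_Mapping.single h a + Poly_Mapping.single (h + 1) b))) =
      a * snd (v h) + b * snd (v (h + 1))"
  using assms gen_snd_pos[of h] gen_snd_pos[of "h + 1"]
  by (auto simp: val_add val_single scale_def gen_def emb_def)

lemma standard_pairI: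
  assumes "lo \<le> h" "h \<le> hi" "0 < a" "0 < b \<longrightarrow> h + 1 \<le> hi"
  shows "standard (Poly_Mapping.single h a + Poly_Mapping.single (h + 1) b)"
  unfolding standard_def normal_rep_def using assms emb_val_pair[OF assms(1,2,4)] by blast

lemma standard_exists:
  assumes "emb w \<in> M" "w \<noteq> 0"
  obtains h a b where "normal_rep h a b (emb w)"
    "val (Poly_Mapping.single h a + Poly_Mapping.single (h + 1) b) = w"
proof -
  have "emb w \<noteq> 0" using assms(2) emb_eq_iff[of w 0] by simp
  then obtain h a b where n: "normal_rep h a b (emb w)"
    using normal_rep_exists assms(1) by blast
  then have "emb (val (Poly_Mapping.single h a + Poly_Mapping.single (h + 1) b)) = emb w"
    using emb_val_pair[of h b a] by (simp add: normal_rep_def prod_eq_iff)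
  with n that show thesis by (simp add: emb_eq_iff)
qed

text \<open>Uniqueness of normal forms carries over to monomials; the monomial \<open>1\<close> is
  told from the others by its vanishing denominator.\<close>

lemma standard_unique:
  assumes "standard m" "standard n" "val m = val n"
  shows "m = n"
proof -
  have z: "m' = 0" if m': "standard m'" "val m' = 0" for m'
  proof (rule ccontr)
    assume "m' \<noteq> 0"
    then obtain h a b where "normal_rep h a b (emb (val m'))" using m'(1) by (auto simp: standard_def)
    then show False using normal_rep_pos m'(2) by fastforce
  qed
  show ?thesis
  proof (cases "m = 0 \<or> n = 0")
    case True
    then show ?thesis using z[of m] z[of n] assms by auto
  next
    case False
    then obtain h a b h' a' b' where
      1: "m = Poly_Mapping.single h a + Poly_Mapping.single (h + 1) b" "normal_rep h a b (emb (val m))" and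
      2: "n = Poly_Mapping.single h' a' + Poly_Mapping.single (h' + 1) b'" "normal_rep h' a' b' (emb (val n))"
      using assms(1,2) by (auto simp: standard_def)
    have "h = h'" "a = a'" "b = b'"
      using normal_rep_unique[OF 1(2)[unfolded assms(3)] 2(2)] by simp_all
    then show ?thesis unfolding 1(1) 2(1) by simp
  qed
qed

definition pairs :: "(int \<times> int) set" where
  "pairs = {(i, j). lo \<le> i \<and> i + 2 \<le> j \<and> j \<le> hi}"

definition pair_exp :: "int \<Rightarrow> int \<Rightarrow> int \<Rightarrow>\<^sub>0 nat" where
  "pair_exp i j = Poly_Mapping.single i 1 + Poly_Mapping.single j 1"

text \<open>Describes the admissible second terms of the relation for \<open>(i, j)\<close>:
  equality of values puts the difference into the kernel, and \<open>2 \<le> a\<close> keeps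
  \<open>n\<close> from being a single variable, which could divide some
  \<open>x_k x_l\<close>.\<close>

definition straightening :: "int \<Rightarrow> int \<Rightarrow> (int \<Rightarrow>\<^sub>0 nat) \<Rightarrow> bool" where
  "straightening i j n \<longleftrightarrow> val n = val (pair_exp i j) \<and>
     ((\<exists>h a. i < h \<and> h < j \<and> 2 \<le> a \<and> n = Poly_Mapping.single h a) \<or>
      (\<exists>h a b. i < h \<and> h + 1 < j \<and> 0 < a \<and> 0 < b \<and>
         n = Poly_Mapping.single h a + Poly_Mapping.single (h + 1) b))"

lemma straightening_exists:
  assumes "(i, j) \<in> pairs"
  shows "\<exists>n. straightening i j n"
proof -
  have ij: "lo \<le> i" "i + 2 \<le> j" "j \<le> hi" "i \<le> hi" "lo \<le> j" using assms by (auto simp: pairs_def)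
  have w: "val (pair_exp i j) = gen i + gen j"
    by (simp add: pair_exp_def val_add val_single)
  have e: "emb (gen i + gen j) = v i + v j" using ij by (simp add: emb_add emb_gen)
  have "emb (gen i + gen j) \<in> M" unfolding e using ij gen_mem by (intro add_mem) auto
  moreover have "gen i + gen j \<noteq> 0"
    using gen_snd_pos[of i] ij by (auto simp: gen_def prod_eq_iff)
  ultimately obtain h a b where n: "normal_rep h a b (v i + v j)"
    "val (Poly_Mapping.single h a + Poly_Mapping.single (h + 1) b) = gen i + gen j"
    using standard_exists e by metis
  note s = normal_rep_gen_add[OF ij(1-3) n(1)]
  show ?thesis
  proof (cases "b = 0")
    case True
    then have "straightening i j (Poly_Mapping.single h a)"
      using s n(2) by (auto simp: straightening_def w)
    then show ?thesis ..
  next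
    case False
    moreover have "0 < a" using n(1) by (simp add: normal_rep_def)
    ultimately have "straightening i j (Poly_Mapping.single h a + Poly_Mapping.single (h + 1) b)"
      using s n(2) unfolding straightening_def w by blast
    then show ?thesis ..
  qed
qed

lemma straightening_keys:
  "straightening i j n \<Longrightarrow> Poly_Mapping.keys n \<subseteq> {i<..<j}"
  using keys_add by (fastforce simp: straightening_def)

text \<open>Rewriting \<open>x\<^sub>i x\<^sub>j\<close> for the extreme indices \<open>i\<close> and \<open>j\<close> only produces variables strictly
  between them, so it either narrows the index range or lowers the exponent of \<open>x\<^sub>i\<close>.\<close>

lemma reduce_to_standard:
  assumes J: "ideal J (subring_of polys)"
    and rels: "\<And>i j. (i, j) \<in> pairs \<Longrightarrow> straightening i j (rhs i j) \<and> mon (pair_exp i j) - mon (rhs i j) \<in> J"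
    and "lo \<le> i" "j \<le> hi" "Poly_Mapping.keys m \<subseteq> {i..j}"
  shows "\<exists>n. standard n \<and> n \<in> exponents \<and> val n = val m \<and> mon m - mon n \<in> J"
  using assms(3-5)
proof (induction "(nat (j - i + 1), Poly_Mapping.lookup m i)" arbitrary: i j m
    rule: wf_induct_rule[OF wf_lex_prod[OF wf_less_than wf_less_than]])
  case (1 i j m)
  note IH = 1(1) and lo = 1(2) and hi = 1(3) and keys = 1(4)
  have J0: "0 \<in> J" and Jadd: "\<And>x y. x \<in> J \<Longrightarrow> y \<in> J \<Longrightarrow> x + y \<in> J"
    and Jmult: "\<And>x y. x \<in> polys \<Longrightarrow> y \<in> J \<Longrightarrow> x * y \<in> J"
    using polys.idealD[OF J] by blast+
  have m: "m \<in> exponents" using keys lo hi by (auto simp: exponents_def)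
  have self: ?case if "standard m" using that m J0 by auto
  consider "j < i" | "i \<le> j" "Poly_Mapping.lookup m i = 0" | "i \<le> j" "Poly_Mapping.lookup m j = 0"
    | "i \<le> j" "0 < Poly_Mapping.lookup m i" "0 < Poly_Mapping.lookup m j" by linarith
  then show ?case
  proof cases
    case 1
    then have "Poly_Mapping.keys m = {}" using keys by auto
    then have "m = 0" by (metis in_keys_iff empty_iff lookup_zero poly_mapping_eqI)
    then show ?thesis using self by (simp add: standard_def)
  next
    case 2
    have "k \<noteq> i" if "k \<in> Poly_Mapping.keys m" for k using 2 that by (auto simp: in_keys_iff)
    then have "Poly_Mapping.keys m \<subseteq> {i + 1..j}" using keys by force
    moreover have "((nat (j - (i + 1) + 1), Poly_Mapping.lookup m (i + 1)),
        (nat (j - i + 1), Poly_Mapping.lookup m i)) \<in> less_than <*lex*> less_than"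
      using 2 by simp
    ultimately show ?thesis using lo hi IH[of j "i + 1" m] by simp
  next
    case 3
    have "k \<noteq> j" if "k \<in> Poly_Mapping.keys m" for k using 3 that by (auto simp: in_keys_iff)
    then have "Poly_Mapping.keys m \<subseteq> {i..j - 1}" using keys by force
    then show ?thesis using lo hi 3 IH[of "j - 1" i m] by simp
  next
    case 4
    show ?thesis
    proof (cases "i + 2 \<le> j")
      case False
      \<comment> \<open>Covers \<open>j = i\<close> and \<open>j = i + 1\<close> together: for
        \<open>j = i\<close> the exponent at \<open>i + 1\<close> is zero.\<close>
      have eq: "m = Poly_Mapping.single i (Poly_Mapping.lookup m i) +
          Poly_Mapping.single (i + 1) (Poly_Mapping.lookup m (i + 1))"
      proof (rule poly_mapping_eqI)
        fix k
        show "Poly_Mapping.lookup m k = Poly_Mapping.lookup (Poly_Mapping.single i (Poly_Mapping.lookup m i) +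
          Poly_Mapping.single (i + 1) (Poly_Mapping.lookup m (i + 1))) k"
          using keys False not_in_keys_iff_lookup_eq_zero[of k m]
          by (force simp: lookup_add lookup_single when_def)
      qed
      have "0 < Poly_Mapping.lookup m (i + 1) \<longrightarrow> i + 1 \<le> hi"
      proof
        assume "0 < Poly_Mapping.lookup m (i + 1)"
        then have "i + 1 \<in> Poly_Mapping.keys m" by (simp add: in_keys_iff)
        then show "i + 1 \<le> hi" using keys hi by auto
      qed
      then have "standard m"
        using lo hi 4 by (subst eq) (intro standard_pairI, simp_all)
      then show ?thesis by (rule self)
    next
      case True
      then have ij: "(i, j) \<in> pairs" using lo hi by (simp add: pairs_def)
      let ?n = "rhs i j"
      have n: "straightening i j ?n" "mon (pair_exp i j) - mon ?n \<in> J" using rels[OF ij] by auto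
      define m' where "m' = m - pair_exp i j"
      have lm': "Poly_Mapping.lookup m' k = Poly_Mapping.lookup m k - Poly_Mapping.lookup (pair_exp i j) k" for k
        by (simp add: m'_def minus_poly_mapping.rep_eq)
      have mm: "m = m' + pair_exp i j"
        by (rule poly_mapping_eqI)
          (use 4 True in \<open>auto simp: lookup_add lm' pair_exp_def lookup_single when_def\<close>)
      have km': "Poly_Mapping.keys m' \<subseteq> {i..j}" 
        by (rule order_trans[OF _ keys]) (auto simp: in_keys_iff lm')
      have kn: "Poly_Mapping.keys ?n \<subseteq> {i<..<j}" by (rule straightening_keys[OF n(1)])
      have m'e: "m' \<in> exponents" using km' lo hi by (auto simp: exponents_def)
      have "Poly_Mapping.keys ?n \<subseteq> {i..j}" using kn by auto
      then have "Poly_Mapping.keys (m' + ?n) \<subseteq> {i..j}" using km' keys_add[of m' ?n] by blast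
      moreover have "Poly_Mapping.lookup (m' + ?n) i < Poly_Mapping.lookup m i"
      proof -
        have "i \<notin> Poly_Mapping.keys ?n" using kn by auto
        then have "Poly_Mapping.lookup ?n i = 0" by (simp add: in_keys_iff)
        then show ?thesis using 4 True by (simp add: lookup_add lm' pair_exp_def lookup_single when_def)
      qed
      ultimately obtain n' where n': "standard n'" "n' \<in> exponents" "val n' = val (m' + ?n)"
        "mon (m' + ?n) - mon n' \<in> J"
        using IH[of j i "m' + ?n"] lo hi by auto
      have "val n' = val m" using n' n(1) by (simp add: mm val_add straightening_def)
      moreover have "mon m' * (mon (pair_exp i j) - mon ?n) + (mon (m' + ?n) - mon n') \<in> J"
        using Jadd Jmult mon_mem_polys m'e n(2) n'(4) by blast
      then have "mon m - mon n' \<in> J"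
        by (simp add: mm mult_single right_diff_distrib)
      ultimately show ?thesis using n' by blast
    qed
  qed
qed

section \<open>The kernel of the evaluation map\<close>

definition relator :: "(int \<Rightarrow> int \<Rightarrow> int \<Rightarrow>\<^sub>0 nat) \<Rightarrow> int \<times> int \<Rightarrow> (int \<Rightarrow>\<^sub>0 nat) \<Rightarrow>\<^sub>0 'k" where
  "relator rhs = (\<lambda>(i, j). mon (pair_exp i j) - mon (rhs i j))"

text \<open>Evaluation factors through the algebra of lattice points: \<open>push\<close> replaces
  each monomial by its value, then the injective \<open>lift\<close> follows. For a polynomial in
  the kernel, the coefficients over each fibre of \<open>val\<close> therefore sum to zero.\<close>

definition push :: "((int \<Rightarrow>\<^sub>0 nat) \<Rightarrow>\<^sub>0 'k) \<Rightarrow> (int \<times> nat \<Rightarrow>\<^sub>0 'k)" where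
  "push p = (\<Sum>m\<in>Poly_Mapping.keys p. Poly_Mapping.single (val m) (Poly_Mapping.lookup p m))"

lemma lift_push: "lift (push p) = ev.lift p"
  by (simp add: push_def lift_sum ev.lift_def)

lemma lookup_push:
  "Poly_Mapping.lookup (push p) w =
     (\<Sum>m\<in>{m\<in>Poly_Mapping.keys p. val m = w}. Poly_Mapping.lookup p m)"
  by (simp add: push_def lookup_sum lookup_single when_def sum.inter_filter)

lemma polys_single: "p \<in> polys \<Longrightarrow> m \<in> Poly_Mapping.keys p \<Longrightarrow> m \<in> exponents"
  by (auto simp: polys_def)

text \<open>Modulo \<open>J\<close>, the polynomial \<open>p\<close> is congruent to
  \<open>q\<close>, obtained by replacing each monomial with its standard form. Standard forms agree
  exactly when values agree, so the coefficients of \<open>q\<close> are sums of coefficients of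
  \<open>p\<close> over fibres of \<open>val\<close>, which vanish.\<close>

lemma kernel_subset:
  assumes J: "ideal J (subring_of polys)"
    and rels: "\<And>i j. (i, j) \<in> pairs \<Longrightarrow> straightening i j (rhs i j) \<and> relator rhs (i, j) \<in> J"
    and p: "p \<in> polys" "ev.lift p = 0"
  shows "p \<in> J"
proof -
  have J0: "0 \<in> J" and Jadd: "\<And>x y. x \<in> J \<Longrightarrow> y \<in> J \<Longrightarrow> x + y \<in> J"
    and Jmult: "\<And>x y. x \<in> polys \<Longrightarrow> y \<in> J \<Longrightarrow> x * y \<in> J"
    using polys.idealD[OF J] by blast+
  have "\<exists>n. standard n \<and> n \<in> exponents \<and> val n = val m \<and> mon m - mon n \<in> J"
    if "m \<in> exponents" for m
  proof (rule reduce_to_standard[OF J])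
    show "straightening i j (rhs i j) \<and> mon (pair_exp i j) - mon (rhs i j) \<in> J"
      if "(i, j) \<in> pairs" for i j
      using rels[OF that] by (simp add: relator_def)
  qed (use that in \<open>auto simp: exponents_def\<close>)
  then obtain N where N: "standard (N m)" "val (N m) = val m" "mon m - mon (N m) \<in> J"
    if "m \<in> exponents" for m by metis
  let ?K = "Poly_Mapping.keys p"
  have K: "m \<in> exponents" if "m \<in> ?K" for m using polys_single[OF p(1) that] .
  define q where "q = (\<Sum>m\<in>?K. Poly_Mapping.single (N m) (Poly_Mapping.lookup p m))"
  have push0: "push p = 0" using lift_inj[of "push p"] p(2) by (simp add: lift_push)
  have "q = 0"
  proof (rule poly_mapping_eqI)
    fix n
    have "Poly_Mapping.lookup q n = (\<Sum>m\<in>{m\<in>?K. N m = n}. Poly_Mapping.lookup p m)"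
      by (simp add: q_def lookup_sum lookup_single when_def sum.inter_filter)
    also have "\<dots> = 0"
    proof (cases "\<exists>m\<^sub>0\<in>?K. N m\<^sub>0 = n")
      case True
      then obtain m\<^sub>0 where m0: "m\<^sub>0 \<in> ?K" "N m\<^sub>0 = n" by blast
      have "N m = n \<longleftrightarrow> val m = val m\<^sub>0" if "m \<in> ?K" for m
        using standard_unique[of "N m" "N m\<^sub>0"] N[OF K[OF that]] N[OF K[OF m0(1)]] m0 by metis
      then have "{m\<in>?K. N m = n} = {m\<in>?K. val m = val m\<^sub>0}" by blast
      then show ?thesis using lookup_push[of p "val m\<^sub>0"] push0 by simp
    next
      case False
      then have "{m\<in>?K. N m = n} = {}" by blast
      then show ?thesis by (simp only: sum.empty)
    qed
    finally show "Poly_Mapping.lookup q n = Poly_Mapping.lookup 0 n" by simp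
  qed
  then have "p = (\<Sum>m\<in>?K. Poly_Mapping.single m (Poly_Mapping.lookup p m)) - q"
    by (simp add: sum_single_lookup)
  also have "\<dots> = (\<Sum>m\<in>?K. Poly_Mapping.single 0 (Poly_Mapping.lookup p m) * (mon m - mon (N m)))"
    by (simp add: q_def sum_subtractf[symmetric] right_diff_distrib mult_single)
  also have "\<dots> \<in> J"
  proof -
    have terms: "Poly_Mapping.single 0 (Poly_Mapping.lookup p m) * (mon m - mon (N m)) \<in> J"
      if "m \<in> ?K" for m
      using N(3)[OF K[OF that]] exponents_zero by (intro Jmult mon_mem_polys)
    have sum_mem: "sum f A \<in> J" if "\<And>m. m \<in> A \<Longrightarrow> f m \<in> J" for f and A :: "(int \<Rightarrow>\<^sub>0 nat) set"
      using that by (induction A rule: infinite_finite_induct) (auto intro: J0 Jadd)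
    show ?thesis by (rule sum_mem) (rule terms)
  qed
  finally show ?thesis .
qed

lemma pair_exp_mem: "(i, j) \<in> pairs \<Longrightarrow> pair_exp i j \<in> exponents"
  unfolding pair_exp_def pairs_def by (intro exponents_add exponents_single) auto

lemma straightening_mem:
  assumes "(i, j) \<in> pairs" "straightening i j n"
  shows "n \<in> exponents"
  using straightening_keys[OF assms(2)] assms(1) by (auto simp: exponents_def pairs_def)

lemma relator_mem:
  assumes "(i, j) \<in> pairs" "straightening i j (rhs i j)"
  shows "relator rhs (i, j) \<in> polys"
  using mon_mem_polys[OF pair_exp_mem[OF assms(1)], of 1]
    polys.uminus_mem[OF mon_mem_polys[OF straightening_mem[OF assms], of 1]] polys.add_mem
  by (fastforce simp: relator_def)

theorem genideal_relators:
  assumes rels: "\<And>i j. (i, j) \<in> pairs \<Longrightarrow> straightening i j (rhs i j)"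
  shows "Idl\<^bsub>subring_of polys\<^esub> (relator rhs ` pairs) = {p\<in>polys. ev.lift p = 0}"
proof
  let ?R = "subring_of polys" and ?G = "relator rhs ` pairs"
  have G: "?G \<subseteq> polys" using relator_mem rels by auto
  have "ideal {p\<in>polys. ev.lift p = 0} ?R"
    by (rule polys.ideal_subring_of)
      (auto simp: ev.lift_add ev.lift_mult polys.zero_mem polys.add_mem polys.mult_mem)
  moreover have "ev.lift (relator rhs (i, j)) = 0" if "(i, j) \<in> pairs" for i j
    using rels[OF that] by (simp add: relator_def ev.lift_diff straightening_def)
  ultimately show "Idl\<^bsub>?R\<^esub> ?G \<subseteq> {p\<in>polys. ev.lift p = 0}"
    using G by (intro polys.ring.genideal_minimal) auto
  have "ideal (Idl\<^bsub>?R\<^esub> ?G) ?R" using polys.ring.genideal_ideal[of ?G] G by simp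
  moreover have "?G \<subseteq> Idl\<^bsub>?R\<^esub> ?G" using polys.ring.genideal_self[of ?G] G by simp
  ultimately show "{p\<in>polys. ev.lift p = 0} \<subseteq> Idl\<^bsub>?R\<^esub> ?G"
    using kernel_subset[of _ rhs] rels by (auto simp: image_subset_iff)
qed

text \<open>The polynomials without monomials dividing \<open>x\<^sub>i x\<^sub>j\<close> form an ideal, which contains all
  relators except the one for \<open>(i, j)\<close>.\<close>

definition avoiding :: "(int \<Rightarrow>\<^sub>0 nat) \<Rightarrow> ((int \<Rightarrow>\<^sub>0 nat) \<Rightarrow>\<^sub>0 'k) set" where
  "avoiding e = {p\<in>polys. \<forall>m n. m + n = e \<longrightarrow> Poly_Mapping.lookup p m = 0}"

lemma ideal_avoiding: "ideal (avoiding e) (subring_of polys)"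
proof (rule polys.ideal_subring_of)
  show "x * y \<in> avoiding e" if x: "x \<in> polys" and y: "y \<in> avoiding e" for x y
  proof -
    have "Poly_Mapping.lookup (x * y) m = 0" if e: "m + n = e" for m n
    proof (rule ccontr)
      assume "Poly_Mapping.lookup (x * y) m \<noteq> 0"
      then have "m \<in> Poly_Mapping.keys (x * y)" by (simp add: in_keys_iff)
      then obtain a b where ab: "m = a + b" "b \<in> Poly_Mapping.keys y" using keys_mult by blast
      have "b + (a + n) = e" using e ab by (simp add: add_ac)
      then show False using y ab(2) by (auto simp: avoiding_def in_keys_iff)
    qed
    then show ?thesis using x y by (auto simp: avoiding_def polys.mult_mem)
  qed
qed (auto simp: avoiding_def polys.zero_mem polys.add_mem lookup_add)

lemma lookup_pair_exp:
  "Poly_Mapping.lookup (pair_exp i j) k = (if k = i then 1 else 0) + (if k = j then 1 else 0)"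
  by (simp add: pair_exp_def lookup_add lookup_single when_def)

text \<open>A second term contains a square or a product of two neighbouring variables, whereas
  \<open>x_i x_j\<close> is squarefree with indices at distance at least two.\<close>

lemma straightening_not_dvd:
  assumes kl: "straightening k l n" and ij: "(i, j) \<in> pairs"
  shows "n + m \<noteq> pair_exp i j"
proof
  assume e: "n + m = pair_exp i j"
  then have le: "Poly_Mapping.lookup n x \<le> Poly_Mapping.lookup (pair_exp i j) x" for x
    by (metis lookup_add le_add1)
  have "i + 2 \<le> j" using ij by (simp add: pairs_def)
  from kl consider h a where "2 \<le> a" "n = Poly_Mapping.single h a"
    | h a b where "0 < a" "0 < b" "n = Poly_Mapping.single h a + Poly_Mapping.single (h + 1) b"
    unfolding straightening_def by blast
  then show False
  proof cases
    case 1
    then show ?thesis using le[of h] \<open>i + 2 \<le> j\<close> by (auto simp: lookup_pair_exp split: if_splits)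
  next
    case 2
    then show ?thesis using le[of h] le[of "h + 1"] \<open>i + 2 \<le> j\<close>
      by (auto simp: lookup_pair_exp lookup_add lookup_single when_def split: if_splits)
  qed
qed

lemma pair_exp_dvd:
  assumes ij: "(i, j) \<in> pairs" and kl: "(k, l) \<in> pairs" and e: "pair_exp k l + m = pair_exp i j"
  shows "(k, l) = (i, j)"
proof -
  from e have le: "Poly_Mapping.lookup (pair_exp k l) x \<le> Poly_Mapping.lookup (pair_exp i j) x" for x
    by (metis lookup_add le_add1)
  show ?thesis using le[of k] le[of l] ij kl
    by (auto simp: lookup_pair_exp pairs_def split: if_splits)
qed

lemma relator_avoiding_iff:
  assumes rels: "\<And>i j. (i, j) \<in> pairs \<Longrightarrow> straightening i j (rhs i j)"
    and ij: "(i, j) \<in> pairs" and kl: "(k, l) \<in> pairs"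
  shows "relator rhs (k, l) \<in> avoiding (pair_exp i j) \<longleftrightarrow> (k, l) \<noteq> (i, j)"
proof
  assume ne: "(k, l) \<noteq> (i, j)"
  have "Poly_Mapping.lookup (relator rhs (k, l)) m = 0" if "m + n = pair_exp i j" for m n
    using that ne pair_exp_dvd[OF ij kl] straightening_not_dvd[OF rels[OF kl] ij]
    by (auto simp: relator_def lookup_minus lookup_single when_def)
  then show "relator rhs (k, l) \<in> avoiding (pair_exp i j)"
    using relator_mem[OF kl, of rhs] rels[OF kl] by (auto simp: avoiding_def)
next
  assume kl': "relator rhs (k, l) \<in> avoiding (pair_exp i j)"
  show "(k, l) \<noteq> (i, j)"
  proof
    assume "(k, l) = (i, j)"
    moreover have "rhs i j \<noteq> pair_exp i j"
      using straightening_not_dvd[OF rels[OF ij] ij, of 0] by simp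
    ultimately have "Poly_Mapping.lookup (relator rhs (k, l)) (pair_exp i j) = 1"
      by (simp add: relator_def lookup_minus lookup_single)
    moreover have "Poly_Mapping.lookup (relator rhs (k, l)) (pair_exp i j) = 0"
      using kl' add_0_right[of "pair_exp i j"] unfolding avoiding_def by blast
    ultimately show False by simp
  qed
qed

text \<open>The ideal \<open>avoiding (pair_exp i j)\<close> tells the relator of
  \<open>(i, j)\<close> from all others. Injectivity is what makes the number of relations equal to
  the number of pairs.\<close>

lemma inj_on_relator:
  assumes rels: "\<And>i j. (i, j) \<in> pairs \<Longrightarrow> straightening i j (rhs i j)"
  shows "inj_on (relator rhs) pairs"
proof (rule inj_onI, unfold split_paired_all)
  fix i j k l
  assume ij: "(i, j) \<in> pairs" and kl: "(k, l) \<in> pairs"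
    and eq: "relator rhs (i, j) = relator rhs (k, l)"
  have "relator rhs (i, j) \<notin> avoiding (pair_exp i j)"
    using relator_avoiding_iff[OF rels ij ij] by blast
  then show "(i, j) = (k, l)" unfolding eq using relator_avoiding_iff[OF rels ij kl] by metis
qed

theorem relators_minimal:
  assumes rels: "\<And>i j. (i, j) \<in> pairs \<Longrightarrow> straightening i j (rhs i j)"
    and H: "H \<subset> relator rhs ` pairs"
  shows "Idl\<^bsub>subring_of polys\<^esub> H \<noteq> {p\<in>polys. ev.lift p = 0}"
proof
  assume eq: "Idl\<^bsub>subring_of polys\<^esub> H = {p\<in>polys. ev.lift p = 0}"
  from H obtain i j where ij: "(i, j) \<in> pairs" "relator rhs (i, j) \<notin> H" by auto
  have "H \<subseteq> avoiding (pair_exp i j)"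
  proof
    fix x assume x: "x \<in> H"
    then have "x \<in> relator rhs ` pairs" using H by blast
    then obtain k l where kl: "(k, l) \<in> pairs" "x = relator rhs (k, l)"
      by (metis imageE surj_pair)
    have "(k, l) \<noteq> (i, j)" using ij(2) x unfolding kl(2) by metis
    then show "x \<in> avoiding (pair_exp i j)"
      unfolding kl(2) using relator_avoiding_iff[OF rels ij(1) kl(1)] by blast
  qed
  then have "Idl\<^bsub>subring_of polys\<^esub> H \<subseteq> avoiding (pair_exp i j)"
    by (rule polys.ring.genideal_minimal[OF ideal_avoiding])
  moreover have "relator rhs (i, j) \<in> Idl\<^bsub>subring_of polys\<^esub> H"
    unfolding eq using rels[OF ij(1)] relator_mem[OF ij(1), of rhs]
    by (auto simp: relator_def ev.lift_diff straightening_def)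
  ultimately show False using relator_avoiding_iff[OF rels ij(1) ij(1)] by auto
qed

section \<open>Generators of the monoid algebra\<close>

definition points :: "(int \<times> nat) set" where
  "points = {w. emb w \<in> M}"

lemma points_zero: "0 \<in> points"
  using zero_mem by (simp add: points_def)

lemma points_add: "a \<in> points \<Longrightarrow> b \<in> points \<Longrightarrow> a + b \<in> points"
  by (simp add: points_def emb_add add_mem)

lemma gen_points: "lo \<le> i \<Longrightarrow> i \<le> hi \<Longrightarrow> gen i \<in> points"
  by (simp add: points_def emb_gen gen_mem)

sublocale points: class_subring "span points"
  using points_zero points_add by (rule class_subring_span)

lemma const_mem_span: "0 \<in> W \<Longrightarrow> \<kappa> x \<in> span W"
  using span_single[of 0 W x] by (simp add: T_zero)

lemma T_mem_span: "w \<in> W \<Longrightarrow> T w \<in> span W"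
  using span_single[of w W 1] by (simp add: \<kappa>_one)

lemma T_mem_span_iff: "T w \<in> span W \<longleftrightarrow> w \<in> W"
proof
  assume "T w \<in> span W"
  then obtain p where p: "Poly_Mapping.keys p \<subseteq> W" "T w = lift p" by (auto simp: span_def)
  then have "lift (p - mon w) = 0" by (simp add: lift_diff \<kappa>_one)
  then have "p = mon w" using lift_inj by fastforce
  then show "w \<in> W" using p(1) by simp
qed (rule T_mem_span)

lemma T_eq_iff: "T u = T w \<longleftrightarrow> u = w"
  using T_mem_span_iff[of u "{w}"] T_mem_span[of w "{w}"] by auto

lemma gen_eq_iff: "lo \<le> i \<Longrightarrow> i \<le> hi \<Longrightarrow> lo \<le> j \<Longrightarrow> j \<le> hi \<Longrightarrow> gen i = gen j \<longleftrightarrow> i = j"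
  using wedge_gens[of i j] wedge_gens[of j i] emb_gen[of i] emb_gen[of j]
  by (cases i j rule: linorder_cases) auto

theorem generators:
  "generate_ring (subring_of (span points)) (range \<kappa> \<union> (\<lambda>i. T (gen i)) ` {lo..hi}) = span points"
    (is "generate_ring ?S ?H = _")
proof
  have H: "?H \<subseteq> span points"
    by (auto simp: const_mem_span points_zero T_mem_span gen_points)
  show "generate_ring ?S ?H \<subseteq> span points"
    using H points.class_subring_axioms by (rule points.generate_ring_subset) simp
  interpret G: class_subring "generate_ring ?S ?H"
    using H by (rule points.class_subring_generate_ring)
  show "span points \<subseteq> generate_ring ?S ?H"
  proof (rule span_subset[OF G.class_subring_axioms])
    show "range \<kappa> \<subseteq> generate_ring ?S ?H" by (auto intro: generate_ring.incl)
    show "T ` points \<subseteq> generate_ring ?S ?H"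
    proof
      fix x assume "x \<in> T ` points"
      then obtain w where w: "w \<in> points" "x = T w" by blast
      show "x \<in> generate_ring ?S ?H"
      proof (cases "w = 0")
        case True
        then show ?thesis using G.one_mem w by (simp add: T_zero)
      next
        case False
        then obtain h a b where n: "normal_rep h a b (emb w)"
          "val (Poly_Mapping.single h a + Poly_Mapping.single (h + 1) b) = w"
          using standard_exists w(1) unfolding points_def by blast
        have "T (gen i) ^ k \<in> generate_ring ?S ?H" if "lo \<le> i \<and> i \<le> hi \<or> k = 0" for i k
        proof (cases "k = 0")
          case True then show ?thesis using G.one_mem by simp
        next
          case False
          then show ?thesis using that by (intro G.power_mem generate_ring.incl) auto
        qed
        moreover have "x = T (gen h) ^ a * T (gen (h + 1)) ^ b"
          using n(2)[symmetric] w(2) by (simp add: val_add val_single T_add T_scale)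
        ultimately show ?thesis using n(1) by (auto simp: normal_rep_def intro!: G.mult_mem)
      qed
    qed
  qed
qed

text \<open>Removing an irreducible point from the monoid leaves a submonoid. Its span is a subring
  containing the constants and all other generators but, by linear independence, not the removed
  monomial.\<close>

theorem generators_minimal:
  assumes J: "J \<subset> {lo..hi}"
  shows "generate_ring (subring_of (span points)) (range \<kappa> \<union> (\<lambda>i. T (gen i)) ` J) \<noteq> span points"
    (is "generate_ring ?S ?H \<noteq> _")
proof
  assume eq: "generate_ring ?S ?H = span points"
  from psubset_imp_ex_mem[OF J] obtain i where i: "lo \<le> i" "i \<le> hi" "i \<notin> J" by auto
  let ?W = "points - {gen i}"
  have nz: "gen i \<noteq> 0" using gen_nonzero[of i] emb_gen[of i] i by auto
  have W0: "0 \<in> ?W" using points_zero nz by simp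
  have Wadd: "a + b \<in> ?W" if "a \<in> ?W" "b \<in> ?W" for a b
  proof -
    have "a + b \<noteq> gen i"
    proof
      assume ab: "a + b = gen i"
      then have "v i = emb a + emb b" using i by (simp add: emb_gen[symmetric] emb_add[symmetric])
      moreover have "emb a \<in> M" "emb b \<in> M" using that by (simp_all add: points_def)
      ultimately have "emb a = 0 \<or> emb b = 0" using irred_gen[OF i(1,2)] unfolding irred_def by blast
      then have "a = 0 \<or> b = 0" using emb_eq_iff[of _ 0] by simp
      then show False using ab that by auto
    qed
    then show ?thesis using points_add that by simp
  qed
  have H: "?H \<subseteq> span ?W"
  proof -
    have "T (gen j) \<in> span ?W" if "j \<in> J" for j
    proof -
      have "j \<in> {lo..hi}" "j \<noteq> i" using that J i(3) by blast+
      then have "gen j \<in> ?W" using gen_eq_iff[of j i] gen_points[of j] i(1,2) by simp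
      then show ?thesis by (rule T_mem_span)
    qed
    then show ?thesis using const_mem_span[OF W0] by blast
  qed
  have "generate_ring ?S ?H \<subseteq> span ?W"
    by (rule points.generate_ring_subset[OF H class_subring_span[OF W0 Wadd] span_mono]) auto
  moreover have "T (gen i) \<in> span points" using T_mem_span gen_points i by simp
  ultimately have "T (gen i) \<in> span ?W" using eq by blast
  then show False by (simp add: T_mem_span_iff)
qed

end

text \<open>Raising the upper bound by one adds the pairs with the new largest \<open>j\<close>, and
  there are \<open>n\<close> of them; Pascal's rule does the rest.\<close>

lemma card_separated_pairs:
  "card {(i :: int, j). lo \<le> i \<and> i + 2 \<le> j \<and> j \<le> lo + int n} = n choose 2"
proof (induction n)
  case 0
  have "{(i :: int, j). lo \<le> i \<and> i + 2 \<le> j \<and> j \<le> lo + int 0} = {}" by auto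
  then show ?case by (simp only: card.empty binomial_eq_0 zero_less_numeral)
next
  case (Suc n)
  let ?A = "\<lambda>n. {(i :: int, j). lo \<le> i \<and> i + 2 \<le> j \<and> j \<le> lo + int n}"
  let ?B = "(\<lambda>i. (i, lo + int (Suc n))) ` {lo..<lo + int n}"
  have "?A n \<subseteq> {lo..lo + int n} \<times> {lo..lo + int n}" by auto
  then have "finite (?A n)" by (rule finite_subset) simp
  moreover have "?A (Suc n) = ?A n \<union> ?B" by (auto simp: image_iff)
  moreover have "?A n \<inter> ?B = {}" by auto
  moreover have "card ?B = n" by (subst card_image) (auto simp: inj_on_def)
  ultimately have "card (?A (Suc n)) = (n choose 2) + n" using Suc by (simp add: card_Un_disjoint)
  then show ?case by (simp add: numeral_2_eq_2)
qed

subsection \<open>Rational functions on the projective line\<close>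

lemma rational_points_closed: "X \<in> rational_points \<Longrightarrow> X \<in> closed_points"
proof -
  have "irreducible [:- a, 1:]" for a :: 'a
    by (rule irreducible_linear_field_poly) simp
  then show "X \<in> rational_points \<Longrightarrow> X \<in> closed_points"
    by (auto simp: rational_points_def closed_points_def)
qed

lemma quot_order_mult:
  assumes "X \<in> closed_points" "a \<noteq> 0" "b \<noteq> 0" "c \<noteq> 0" "d \<noteq> 0"
  shows "quot_order X (a * c) (b * d) = quot_order X a b + quot_order X c d"
  using assms by (cases X) (auto simp: closed_points_def poly_multiplicity_mult degree_mult_eq)

lemma place_order_mult:
  assumes X: "X \<in> closed_points" and "f \<noteq> 0" "g \<noteq> 0"
  shows "place_order X (f * g) = place_order X f + place_order X g"
proof -
  from assms obtain a b where f: "f = Fraction_Field.Fract a b" "a \<noteq> 0" "b \<noteq> 0"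
    by (metis Fract_cases_nonzero)
  from assms obtain c d where g: "g = Fraction_Field.Fract c d" "c \<noteq> 0" "d \<noteq> 0"
    by (metis Fract_cases_nonzero)
  show ?thesis using f g X by (simp add: place_order_Fract quot_order_mult)
qed

lemma place_order_one: "X \<in> closed_points \<Longrightarrow> place_order X 1 = 0"
  using place_order_mult[of X 1 1] by simp

lemma place_order_inverse:
  assumes "X \<in> closed_points" "f \<noteq> 0"
  shows "place_order X (inverse f) = - place_order X f"
  using place_order_mult[of X f "inverse f"] place_order_one[of X] assms by simp

lemma place_order_power:
  assumes "X \<in> closed_points" "f \<noteq> 0"
  shows "place_order X (f ^ n) = int n * place_order X f"
  using assms by (induction n) (simp_all add: place_order_one place_order_mult algebra_simps)

lemma place_order_power_int:
  assumes "X \<in> closed_points" "f \<noteq> 0"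
  shows "place_order X (f powi n) = n * place_order X f"
  using assms by (simp add: power_int_def place_order_power place_order_inverse)

lemma poly_multiplicity_eq_0:
  assumes "irreducible p" "\<not> p dvd a"
  shows "poly_multiplicity p a = 0"
  using assms by (intro poly_multiplicity_eqI[of _ _ _ a]) auto

lemma poly_multiplicity_pos:
  assumes "irreducible p" "a \<noteq> 0" "p dvd a"
  shows "0 < poly_multiplicity p a"
proof (rule ccontr)
  assume "\<not> ?thesis"
  then have "poly_multiplicity p a = 0" by simp
  with poly_multiplicity_decomp[OF assms(1,2)] assms(3) show False by (metis mult_1 power_0)
qed

lemma place_order_to_fract:
  assumes "X \<in> closed_points" "a \<noteq> 0"
  shows "place_order X (to_fract a) = (case X of None \<Rightarrow> - int (degree a) | Some p \<Rightarrow> int (poly_multiplicity p a))"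
proof -
  have "place_order X (Fraction_Field.Fract a 1) = quot_order X a 1"
    using assms by (intro place_order_Fract) auto
  moreover have "poly_multiplicity p 1 = 0" if "X = Some p" for p
    using assms(1) that by (intro poly_multiplicity_eq_0) (auto simp: closed_points_def irreducible_def)
  ultimately show ?thesis by (cases X) (simp_all add: to_fract_def)
qed

lemma monic_irreducible_divisor_exists:
  fixes b :: "'a::field poly"
  assumes "0 < degree b"
  shows "\<exists>p. irreducible p \<and> lead_coeff p = 1 \<and> p dvd b"
  using assms
proof (induction "degree b" arbitrary: b rule: less_induct)
  case less
  have b: "b \<noteq> 0" using less.prems by auto
  then have unit: "\<not> is_unit b" using less.prems is_unit_iff_degree[of b] by simp
  show ?case
  proof (cases "irreducible b")
    case True
    let ?p = "[:inverse (lead_coeff b):] * b"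
    have u: "is_unit [:inverse (lead_coeff b):]" using b by (intro is_unit_triv) auto
    have "irreducible ?p" using True u by (simp only: irreducible_mult_unit_left)
    moreover have "lead_coeff ?p = 1" using b by simp
    moreover have "?p dvd b" using u by (metis dvd_refl mult_unit_dvd_iff')
    ultimately show ?thesis by blast
  next
    case False
    then obtain c d where cd: "b = c * d" "\<not> is_unit c" "\<not> is_unit d"
      using b unit by (auto simp: irreducible_def)
    then have nz: "c \<noteq> 0" "d \<noteq> 0" using b by auto
    then have "0 < degree c" "0 < degree d" using cd is_unit_iff_degree[of c] is_unit_iff_degree[of d] nz by auto
    then have "degree c < degree b" using cd nz by (simp add: degree_mult_eq)
    from less.hyps[OF this \<open>0 < degree c\<close>] show ?thesis using cd by auto
  qed
qed

text \<open>An irreducible factor of the denominator also divides the numerator, because the order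
  at its place is nonnegative. Cancelling it lowers the degree of the denominator, until only a
  constant is left.\<close>

lemma regular_imp_polynomial:
  fixes f :: "'a::field poly fract"
  assumes "f \<noteq> 0" and reg: "\<And>p. Some p \<in> closed_points \<Longrightarrow> 0 \<le> place_order (Some p) f"
  obtains n where "f = to_fract n" "n \<noteq> 0"
proof -
  have "\<exists>n. n \<noteq> 0 \<and> f = to_fract n" if "f = Fraction_Field.Fract a b" "a \<noteq> 0" "b \<noteq> 0" for a b
    using that
  proof (induction "degree b" arbitrary: a b rule: less_induct)
    case less
    show ?case
    proof (cases "degree b = 0")
      case True
      then obtain x where x: "b = [:x:]" by (rule degree_eq_zeroE)
      then have "x \<noteq> 0" using less.prems by auto
      then have "f = to_fract (smult (inverse x) a)"
        using less.prems x by (simp add: to_fract_def eq_fract)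
      moreover have "smult (inverse x) a \<noteq> 0" using less.prems \<open>x \<noteq> 0\<close> by simp
      ultimately show ?thesis by blast
    next
      case False
      then obtain p where p: "irreducible p" "lead_coeff p = 1" "p dvd b"
        using monic_irreducible_divisor_exists by blast
      then have X: "Some p \<in> closed_points" by (auto simp: closed_points_def)
      have "poly_multiplicity p b \<le> poly_multiplicity p a"
        using reg[OF X] less.prems place_order_Fract[OF X, of a b] by simp
      then have "p dvd a"
        using poly_multiplicity_pos[OF p(1) less.prems(3) p(3)] poly_multiplicity_eq_0[OF p(1), of a]
        by fastforce
      then obtain a' b' where ab: "a = p * a'" "b = p * b'" using p(3) by (auto elim!: dvdE)
      then have nz: "p \<noteq> 0" "a' \<noteq> 0" "b' \<noteq> 0" using less.prems by auto
      have "0 < degree p" using p(1) nz is_unit_iff_degree[of p] by (auto simp: irreducible_def)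
      then have "degree b' < degree b" using ab nz by (simp add: degree_mult_eq)
      moreover have "f = Fraction_Field.Fract a' b'" using less.prems nz ab by (simp add: eq_fract)
      ultimately show ?thesis using less.hyps nz by blast
    qed
  qed
  moreover obtain a b where "f = Fraction_Field.Fract a b" "a \<noteq> 0" "b \<noteq> 0"
    using assms(1) by (metis Fract_cases_nonzero)
  ultimately show thesis using that by blast
qed

text \<open>An affine equation of a rational point. With the value \<open>1\<close> at infinity, the
  divisor of \<open>point_poly Y\<close> is \<open>Y\<close> minus the point at infinity for every
  rational \<open>Y\<close>, infinity itself included.\<close>

definition point_poly :: "'a::field p1_point \<Rightarrow> 'a poly" where
  "point_poly X = (case X of None \<Rightarrow> 1 | Some p \<Rightarrow> p)"

lemma point_poly_nonzero: "X \<in> rational_points \<Longrightarrow> point_poly X \<noteq> 0"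
  by (auto simp: point_poly_def rational_points_def)

lemma monic_dvd_linear:
  fixes p :: "'a::field poly"
  assumes "irreducible p" "lead_coeff p = 1" "p dvd [:- a, 1:]"
  shows "p = [:- a, 1:]"
proof -
  from assms(3) obtain c where c: "[:- a, 1:] = p * c" by (elim dvdE)
  then have nz: "p \<noteq> 0" "c \<noteq> 0" by auto
  have "0 < degree p" using assms(1) nz is_unit_iff_degree[of p] by (auto simp: irreducible_def)
  moreover have "degree p + degree c = 1" using c nz degree_mult_eq[of p c] by (metis degree_pCons_eq_if one_neq_zero pCons_eq_0_iff degree_0 One_nat_def)
  ultimately have "degree c = 0" by simp
  then obtain x where x: "c = [:x:]" by (rule degree_eq_zeroE)
  have "lead_coeff (p * c) = 1" unfolding c[symmetric] by simp
  then have "x = 1" using assms(2) x by (simp add: lead_coeff_mult del: mult_pCons_right)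
  then show ?thesis using c x by simp
qed

lemma place_order_point_poly:
  assumes X: "X \<in> closed_points" and Y: "Y \<in> rational_points" and "k \<noteq> 0"
  shows "place_order X (to_fract (smult k (point_poly Y))) = of_bool (X = Y) - of_bool (X = None)"
proof -
  have nz: "point_poly Y \<noteq> 0" "smult k (point_poly Y) \<noteq> 0"
    using point_poly_nonzero[OF Y] assms(3) by auto
  show ?thesis
  proof (cases X)
    case None
    then show ?thesis using place_order_to_fract[OF X nz(2)] assms(3) Y
      by (auto simp: point_poly_def rational_points_def)
  next
    case (Some p)
    then have p: "irreducible p" "lead_coeff p = 1" using X by (auto simp: closed_points_def)
    have dvd: "p dvd smult k (point_poly Y) \<longleftrightarrow> p dvd point_poly Y"
      using assms(3) by (rule dvd_smult_iff)
    have "int (poly_multiplicity p (smult k (point_poly Y))) = of_bool (X = Y)"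
    proof (cases "Y = Some p")
      case True
      have "poly_multiplicity p (smult k (point_poly Y)) = 1"
      proof (rule poly_multiplicity_eqI[OF p(1)])
        show "smult k (point_poly Y) = p ^ 1 * [:k:]" using True by (simp add: point_poly_def)
        show "\<not> p dvd [:k:]"
          using p(1) is_unit_triv[OF assms(3)] dvd_unit_imp_unit irreducible_def by blast
      qed
      then show ?thesis using True Some by simp
    next
      case False
      have "\<not> p dvd point_poly Y"
      proof
        assume d: "p dvd point_poly Y"
        show False
        proof (cases Y)
          case None
          then show False using d p by (simp add: point_poly_def irreducible_def)
        next
          case (Some l)
          then obtain a where "l = [:- a, 1:]" using Y by (auto simp: rational_points_def)
          then show False using monic_dvd_linear[OF p, of a] d False Some by (simp add: point_poly_def)
        qed
      qed
      then show ?thesis using poly_multiplicity_eq_0[OF p(1)] dvd False Some by auto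
    qed
    then show ?thesis using place_order_to_fract[OF X nz(2)] Some by simp
  qed
qed

lemma dvd_degree_1:
  fixes e :: "'a::field"
  assumes "[:- e, 1:] dvd l" "l \<noteq> 0" "degree l \<le> 1"
  shows "\<exists>k. k \<noteq> 0 \<and> l = smult k [:- e, 1:]"
proof -
  from assms(1) obtain m where m: "l = [:- e, 1:] * m" by (elim dvdE)
  then have nz: "m \<noteq> 0" using assms(2) by auto
  have "degree l = degree [:- e, 1:] + degree m" unfolding m by (rule degree_mult_eq) (use nz in auto)
  then have "degree m = 0" using assms(3) by simp
  then obtain k where "m = [:k:]" by (rule degree_eq_zeroE)
  then have "k \<noteq> 0" "l = smult k [:- e, 1:]" using nz m by auto
  then show ?thesis by blast
qed

text \<open>Numerator and denominator of a fractional linear function have degree at most one. The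
  pole makes the denominator vanish at \<open>P\<close>, the zero makes the numerator vanish at
  \<open>Q\<close>; if the point is at infinity, comparing degrees shows that the polynomial in
  question is constant.\<close>

lemma coordinate_form:
  fixes t :: "'a::field poly fract"
  assumes t: "rational_coordinate t" and P: "P \<in> rational_points" and Q: "Q \<in> rational_points"
    and pole: "place_order P t < 0" and zero: "0 < place_order Q t"
  shows "\<exists>k l. k \<noteq> 0 \<and> l \<noteq> 0 \<and>
    t = to_fract (smult k (point_poly Q)) / to_fract (smult l (point_poly P))"
proof -
  from t obtain a b c d where det: "a * d - b * c \<noteq> 0"
    and t: "t = Fraction_Field.Fract [:b, a:] [:d, c:]"
    by (auto simp: rational_coordinate_def)
  let ?n = "[:b, a:]" and ?m = "[:d, c:]"
  have nz: "?n \<noteq> 0" "?m \<noteq> 0" using det by auto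
  note ord = place_order_Fract[OF rational_points_closed nz]
  have "\<exists>l. l \<noteq> 0 \<and> ?m = smult l (point_poly P)"
  proof (cases P)
    case None
    then have "degree ?m < degree ?n" using pole ord[OF P] by (simp add: t)
    then have "degree ?m = 0" by (simp split: if_splits)
    then have "c = 0" by (simp split: if_splits)
    then show ?thesis using None nz by (intro exI[of _ d]) (simp add: point_poly_def)
  next
    case (Some p)
    then obtain e where e: "p = [:- e, 1:]" using P by (auto simp: rational_points_def)
    have irr: "irreducible p" using rational_points_closed[OF P] Some by (auto simp: closed_points_def)
    have "poly_multiplicity p ?m \<noteq> 0" using pole ord[OF P] Some by (simp add: t)
    then have "p dvd ?m" using poly_multiplicity_eq_0[OF irr, of ?m] by metis
    then show ?thesis using dvd_degree_1[of e ?m] nz Some e by (simp add: point_poly_def del: smult_pCons)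
  qed
  moreover have "\<exists>k. k \<noteq> 0 \<and> ?n = smult k (point_poly Q)"
  proof (cases Q)
    case None
    then have "degree ?n < degree ?m" using zero ord[OF Q] by (simp add: t)
    then have "degree ?n = 0" by (simp split: if_splits)
    then have "a = 0" by (simp split: if_splits)
    then show ?thesis using None nz by (intro exI[of _ b]) (simp add: point_poly_def)
  next
    case (Some p)
    then obtain e where e: "p = [:- e, 1:]" using Q by (auto simp: rational_points_def)
    have irr: "irreducible p" using rational_points_closed[OF Q] Some by (auto simp: closed_points_def)
    have "poly_multiplicity p ?n \<noteq> 0" using zero ord[OF Q] Some by (simp add: t)
    then have "p dvd ?n" using poly_multiplicity_eq_0[OF irr, of ?n] by metis
    then show ?thesis using dvd_degree_1[of e ?n] nz Some e by (simp add: point_poly_def del: smult_pCons)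
  qed
  ultimately show ?thesis unfolding t Fract_conv_to_fract by metis
qed

abbreviation const_fract :: "'a::field \<Rightarrow> 'a poly fract" where
  "const_fract x \<equiv> to_fract [:x:]"

lemma to_fract_power: "to_fract (p ^ n) = to_fract p ^ n"
  by (induction n) simp_all

lemma to_fract_smult: "to_fract (smult k p) = const_fract k * to_fract p"
  by (simp flip: to_fract_mult)

section \<open>Sections as binary forms in the numerator and denominator of the coordinate\<close>

locale coordinate =
  fixes P Q :: "'a::field p1_point" and k l :: 'a
  assumes P: "P \<in> rational_points" and Q: "Q \<in> rational_points" and P_neq_Q: "P \<noteq> Q"
    and k: "k \<noteq> 0" and l: "l \<noteq> 0"
begin

definition num :: "'a poly" where "num = smult k (point_poly Q)"
definition den :: "'a poly" where "den = smult l (point_poly P)"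
definition coord :: "'a poly fract" where "coord = to_fract num / to_fract den"

lemma nonzero [simp]: "num \<noteq> 0" "den \<noteq> 0" "coord \<noteq> 0"
  using point_poly_nonzero[OF P] point_poly_nonzero[OF Q] k l
  by (simp_all add: num_def den_def coord_def)

lemma place_order_num: "X \<in> closed_points \<Longrightarrow>
    place_order X (to_fract num) = of_bool (X = Q) - of_bool (X = None)"
  and place_order_den: "X \<in> closed_points \<Longrightarrow>
    place_order X (to_fract den) = of_bool (X = P) - of_bool (X = None)"
  unfolding num_def den_def using place_order_point_poly P Q k l by blast+

lemma degree_den: "degree den \<le> 1"
  using P by (auto simp: den_def point_poly_def rational_points_def)

lemma Q_cases:
  obtains (finite) a where "num = smult k [:- a, 1:]" "poly den a \<noteq> 0"
  | (infinite) "num = [:k:]" "degree den = 1"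
proof (cases Q)
  case None
  then have "num = [:k:]" unfolding num_def by (simp add: point_poly_def)
  moreover have "degree den = 1"
    unfolding den_def using P P_neq_Q None l by (auto simp: point_poly_def rational_points_def)
  ultimately show thesis by (rule infinite)
next
  case (Some p)
  then obtain a where a: "p = [:- a, 1:]" using Q by (auto simp: rational_points_def)
  have "num = smult k [:- a, 1:]" unfolding num_def using Some a by (simp add: point_poly_def)
  moreover have "poly den a \<noteq> 0"
    unfolding den_def using P P_neq_Q Some a l by (auto simp: point_poly_def rational_points_def)
  ultimately show thesis by (rule finite)
qed

text \<open>\<open>x\<close> is the value of \<open>n / den ^ Suc N\<close> at the point \<open>Q\<close>.\<close>

lemma subtract_value_at_Q:
  assumes "degree n \<le> Suc N"
  shows "\<exists>x n'. n = smult x (den ^ Suc N) + num * n' \<and> degree n' \<le> N"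
proof -
  have dd: "degree (den ^ Suc N) \<le> Suc N"
    using degree_power_eq[of den "Suc N"] degree_den by (metis nonzero(2) mult.right_neutral mult_le_mono2)
  show ?thesis
  proof (cases rule: Q_cases)
    case (finite a)
    define x where "x = poly n a / poly den a ^ Suc N"
    define r where "r = n - smult x (den ^ Suc N)"
    have "poly r a = 0" using finite by (simp add: r_def x_def)
    then obtain m where m: "r = [:- a, 1:] * m" unfolding poly_eq_0_iff_dvd by (elim dvdE)
    have dr: "degree r \<le> Suc N" unfolding r_def
      using assms dd degree_smult_le[of x "den ^ Suc N"] by (intro degree_diff_le) linarith+
    have dm: "degree m \<le> N"
    proof (cases "m = 0")
      case False
      have "degree r = degree [:- a, 1:] + degree m"
        unfolding m by (rule degree_mult_eq) (use False in auto)
      then show ?thesis using dr by simp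
    qed simp
    have "num * smult (inverse k) m = r"
      unfolding finite(1) m using k by (simp del: mult_pCons_left smult_pCons)
    then have "n = smult x (den ^ Suc N) + num * smult (inverse k) m" by (simp add: r_def)
    moreover have "degree (smult (inverse k) m) \<le> N" using dm degree_smult_le[of "inverse k" m] by linarith
    ultimately show ?thesis by blast
  next
    case infinite
    have deg: "degree (den ^ Suc N) = Suc N" using infinite by (subst degree_power_eq) simp_all
    \<comment> \<open>At infinity the value of the quotient is the ratio of the coefficients in
      degree \<open>Suc N\<close>.\<close>
    define x where "x = coeff n (Suc N) / coeff (den ^ Suc N) (Suc N)"
    define r where "r = n - smult x (den ^ Suc N)"
    have "coeff (den ^ Suc N) (Suc N) \<noteq> 0"
      using leading_coeff_0_iff[of "den ^ Suc N"] unfolding deg by simp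
    then have z: "coeff r (Suc N) = 0" by (simp add: r_def x_def del: power_Suc)
    have dr: "degree r \<le> Suc N" unfolding r_def
      using assms dd degree_smult_le[of x "den ^ Suc N"] by (intro degree_diff_le) linarith+
    have "degree r \<le> N"
    proof (rule degree_le, intro allI impI)
      fix i assume "N < i"
      then show "coeff r i = 0" using z dr coeff_eq_0[of r i] by (cases "i = Suc N") auto
    qed
    moreover have "num * smult (inverse k) r = r" using infinite k by simp
    then have "n = smult x (den ^ Suc N) + num * smult (inverse k) r" by (simp add: r_def)
    moreover have "degree (smult (inverse k) r) \<le> degree r" by (rule degree_smult_le)
    ultimately show ?thesis by (metis order_trans)
  qed
qed

text \<open>A binary form of degree \<open>N\<close> in the linear forms \<open>num\<close> and
  \<open>den\<close>, read in the affine chart. As these vanish at different points, their products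
  of degree \<open>N\<close> are a basis of the polynomials of degree at most
  \<open>N\<close>.\<close>

definition form :: "nat \<Rightarrow> (nat \<Rightarrow> 'a) \<Rightarrow> 'a poly" where
  "form N e = (\<Sum>i\<le>N. smult (e i) (num ^ i * den ^ (N - i)))"

lemma form_Suc: "form (Suc N) e = smult (e 0) (den ^ Suc N) + num * form N (\<lambda>i. e (Suc i))"
  unfolding form_def sum.atMost_Suc_shift by (simp add: sum_distrib_left mult.assoc)

lemma degree_form: "degree (form N e) \<le> N"
  unfolding form_def
proof (rule degree_sum_le)
  fix i assume i: "i \<in> {..N}"
  have "degree num \<le> 1" using Q k by (auto simp: num_def point_poly_def rational_points_def)
  then have "degree (num ^ i) \<le> i" by (simp add: degree_power_eq mult_le_cancel1)
  moreover have "degree (den ^ (N - i)) \<le> N - i" using degree_den by (simp add: degree_power_eq mult_le_cancel1)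
  ultimately have "degree (num ^ i * den ^ (N - i)) \<le> N"
    using degree_mult_le[of "num ^ i" "den ^ (N - i)"] i by simp
  then show "degree (smult (e i) (num ^ i * den ^ (N - i))) \<le> N"
    using degree_smult_le[of "e i" "num ^ i * den ^ (N - i)"] by linarith
qed simp

text \<open>Subtracting a multiple of a power of \<open>den\<close> makes the polynomial vanish at
  \<open>Q\<close>; dividing by \<open>num\<close> then lowers the degree bound by one.\<close>

lemma form_surj:
  assumes "degree n \<le> N"
  shows "\<exists>e. n = form N e"
  using assms
proof (induction N arbitrary: n)
  case 0
  then obtain x where "n = [:x:]" by (auto elim: degree_eq_zeroE)
  then have "n = form 0 (\<lambda>_. x)" by (simp add: form_def)
  then show ?case by blast
next
  case (Suc N)
  from subtract_value_at_Q[OF Suc.prems] obtain x n' where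
    n': "n = smult x (den ^ Suc N) + num * n'" "degree n' \<le> N" by blast
  from Suc.IH[OF n'(2)] obtain e where e: "n' = form N e" by blast
  have "n = form (Suc N) (case_nat x e)" unfolding form_Suc n'(1) e by simp
  then show ?case by blast
qed

text \<open>All terms except the one for \<open>i = 0\<close> vanish at \<open>Q\<close>, which
  isolates \<open>e 0\<close>; then \<open>num\<close> is cancelled. For \<open>Q\<close> at
  infinity the top coefficient replaces the value at \<open>Q\<close>.\<close>

lemma form_inj:
  assumes "form N e = 0" "i \<le> N"
  shows "e i = 0"
  using assms
proof (induction N arbitrary: e i)
  case 0
  then show ?case by (simp add: form_def)
next
  case (Suc N)
  let ?r = "form N (\<lambda>i. e (Suc i))"
  have eq: "smult (e 0) (den ^ Suc N) + num * ?r = 0" using Suc.prems(1) by (simp only: form_Suc)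
  have e0: "e 0 = 0"
  proof (cases rule: Q_cases)
    case (finite a)
    have "poly (smult (e 0) (den ^ Suc N) + num * ?r) a = e 0 * poly den a ^ Suc N"
      using finite(1) by simp
    then show ?thesis using finite(2) unfolding eq by simp
  next
    case infinite
    have deg: "degree (den ^ Suc N) = Suc N" using infinite by (subst degree_power_eq) simp_all
    have "coeff (den ^ Suc N) (Suc N) \<noteq> 0"
      using leading_coeff_0_iff[of "den ^ Suc N"] unfolding deg by simp
    moreover have "coeff (num * ?r) (Suc N) = 0"
      using infinite degree_form[of N "\<lambda>i. e (Suc i)"] by (simp add: coeff_eq_0)
    moreover have "coeff (smult (e 0) (den ^ Suc N) + num * ?r) (Suc N) = 0" unfolding eq by simp
    ultimately show ?thesis by (simp del: power_Suc)
  qed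
  then have "num * ?r = 0" using eq by simp
  then have "?r = 0" by simp
  with Suc.IH[OF this] e0 Suc.prems(2) show ?case by (cases i) auto
qed

text \<open>Over the common denominator \<open>den ^ A * num ^ B\<close>, the power of the
  coordinate with exponent \<open>i - B\<close> has numerator
  \<open>num ^ i * den ^ (N - i)\<close>. Either of \<open>A\<close> and \<open>B\<close> may be
  negative.\<close>

lemma laurent_eq_form:
  fixes A B :: int
  assumes "A + B = int N"
  shows "(\<Sum>i\<le>N. const_fract (e i) * coord powi (int i - B)) =
    to_fract (form N e) / (to_fract den powi A * to_fract num powi B)"
proof -
  have "const_fract (e i) * coord powi (int i - B) =
      to_fract (smult (e i) (num ^ i * den ^ (N - i))) / (to_fract den powi A * to_fract num powi B)"
    if "i \<le> N" for i
  proof -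
    have A: "A = (int i - B) + int (N - i)" using assms that by simp
    have 1: "to_fract den powi A = to_fract den powi (int i - B) * to_fract den ^ (N - i)"
      unfolding A by (subst power_int_add) simp_all
    have "to_fract num powi ((int i - B) + B) = to_fract num powi (int i - B) * to_fract num powi B"
      by (subst power_int_add) simp_all
    then have 2: "to_fract num ^ i = to_fract num powi (int i - B) * to_fract num powi B" by simp
    show ?thesis
      by (simp add: coord_def to_fract_smult to_fract_power power_int_divide_distrib 1 2)
  qed
  then show ?thesis by (simp add: form_def sum_divide_distrib)
qed

lemma laurent_independent:
  assumes C: "finite C" and zero: "(\<Sum>c\<in>C. const_fract (e c) * coord powi c) = 0" and c: "c \<in> C"
  shows "e c = 0"
proof -
  \<comment> \<open>The symmetric window from \<open>- B\<close> to \<open>B\<close> contains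
    \<open>C\<close>. With zero coefficients outside \<open>C\<close>, the shifted sum becomes a
    form of degree \<open>2 * B\<close>.\<close>
  define B where "B = Max ((\<lambda>c. nat \<bar>c\<bar>) ` C)"
  have B: "\<bar>c\<bar> \<le> int B" if "c \<in> C" for c
    using Max_ge[of "(\<lambda>c. nat \<bar>c\<bar>) ` C" "nat \<bar>c\<bar>"] C that by (simp add: B_def nat_le_iff)
  define e' where "e' i = (if int i - int B \<in> C then e (int i - int B) else 0)" for i :: nat
  let ?g = "\<lambda>c. const_fract (e c) * coord powi c"
  have "(\<Sum>i\<le>2 * B. const_fract (e' i) * coord powi (int i - int B)) =
      (\<Sum>i\<le>2 * B. if int i - int B \<in> C then ?g (int i - int B) else 0)"
    by (intro sum.cong) (auto simp: e'_def)
  also have "\<dots> = (\<Sum>i\<in>{i\<in>{..2 * B}. int i - int B \<in> C}. ?g (int i - int B))"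
    by (rule sum.inter_filter[symmetric]) simp
  also have "\<dots> = (\<Sum>c\<in>C. ?g c)"
    by (rule sum.reindex_bij_witness[of _ "\<lambda>c. nat (c + int B)" "\<lambda>i. int i - int B"])
      (auto dest: B)
  finally have "to_fract (form (2 * B) e') /
      (to_fract den powi int B * to_fract num powi int B) = 0"
    using laurent_eq_form[of "int B" "int B" "2 * B" e'] zero by simp
  then have "form (2 * B) e' = 0" by simp
  then have "e' (nat (c + int B)) = 0" by (rule form_inj) (use B[OF c] in auto)
  moreover have "int (nat (c + int B)) - int B = c" using B[OF c] by simp
  ultimately show ?thesis using c unfolding e'_def by simp
qed

lemma place_order_twist:
  assumes X: "X \<in> closed_points" and "f \<noteq> 0"
  shows "place_order X (f * (to_fract den powi A * to_fract num powi B)) =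
    place_order X f + (A * of_bool (X = P) + B * of_bool (X = Q)) - (A + B) * of_bool (X = None)"
  using assms by (simp add: place_order_mult place_order_power_int place_order_num place_order_den
      algebra_simps)

text \<open>The divisor of \<open>den ^ A * num ^ B\<close> is \<open>A P + B Q\<close> minus
  \<open>A + B\<close> times the point at infinity. Multiplication by it moves all poles allowed by
  \<open>E\<close> to infinity, where they become a bound on the degree.\<close>

lemma global_sections_iff_polynomial:
  assumes E: "\<And>X. Poly_Mapping.lookup E X = A * of_bool (X = P) + B * of_bool (X = Q)" and f: "f \<noteq> 0"
  shows "f \<in> global_sections E \<longleftrightarrow>
    (\<exists>n. int (degree n) \<le> A + B \<and> f * (to_fract den powi A * to_fract num powi B) = to_fract n)"
    (is "_ \<longleftrightarrow> (\<exists>n. _ \<and> ?g = _)")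
proof -
  have g: "?g \<noteq> 0" using f by simp
  have ord: "place_order X f + Poly_Mapping.lookup E X = place_order X ?g + (A + B) * of_bool (X = None)"
    if "X \<in> closed_points" for X
    using place_order_twist[OF that f, of A B] by (simp add: E)
  have None: "None \<in> closed_points" by (simp add: closed_points_def)
  show ?thesis
  proof
    assume "f \<in> global_sections E"
    then have ge: "0 \<le> place_order X ?g + (A + B) * of_bool (X = None)" if "X \<in> closed_points" for X
      using f that ord[OF that] by (auto simp: global_sections_def)
    have "0 \<le> place_order (Some p) ?g" if "Some p \<in> closed_points" for p
      using ge[OF that] by simp
    then obtain n where n: "?g = to_fract n" "n \<noteq> 0" by (rule regular_imp_polynomial[OF g])
    then have "int (degree n) \<le> A + B" using ge[OF None] place_order_to_fract[OF None n(2)] by simp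
    then show "\<exists>n. int (degree n) \<le> A + B \<and> ?g = to_fract n" using n by blast
  next
    assume "\<exists>n. int (degree n) \<le> A + B \<and> ?g = to_fract n"
    then obtain n where n: "int (degree n) \<le> A + B" "?g = to_fract n" by blast
    then have n0: "n \<noteq> 0" using g by auto
    have "0 \<le> place_order X ?g + (A + B) * of_bool (X = None)" if X: "X \<in> closed_points" for X
      unfolding n(2) place_order_to_fract[OF X n0] using n(1) by (cases X) simp_all
    then show "f \<in> global_sections E" using ord by (simp add: global_sections_def)
  qed
qed

lemma sum_int_interval:
  fixes A B :: int
  assumes "A + B = int N"
  shows "(\<Sum>c\<in>{- B..A}. g c) = (\<Sum>i\<le>N. g (int i - B))"
  using assms by (intro sum.reindex_bij_witness[of _ "\<lambda>i. int i - B" "\<lambda>c. nat (c + B)"]) auto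

theorem global_sections_eq:
  assumes E: "\<And>X. Poly_Mapping.lookup E X = A * of_bool (X = P) + B * of_bool (X = Q)"
  shows "f \<in> global_sections E \<longleftrightarrow> (\<exists>e. f = (\<Sum>c\<in>{- B..A}. const_fract (e c) * coord powi c))"
proof (cases "f = 0")
  case True
  then show ?thesis by (auto simp: global_sections_def intro!: exI[of _ "\<lambda>_. 0"])
next
  case f: False
  let ?D = "to_fract den powi A * to_fract num powi B"
  have D: "?D \<noteq> 0" by simp
  show ?thesis
  proof (cases "0 \<le> A + B")
    case False
    \<comment> \<open>The divisor has negative degree: the sum is empty, and no nonzero section
      exists.\<close>
    then have "{- B..A} = {}" "\<not> int (degree n) \<le> A + B" for n by auto
    then show ?thesis using f global_sections_iff_polynomial[OF E f] by simp
  next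
    case True
    then obtain N where N: "A + B = int N" using nonneg_int_cases by blast
    have laurent: "(\<Sum>c\<in>{- B..A}. const_fract (e c) * coord powi c) =
        to_fract (form N (\<lambda>i. e (int i - B))) / ?D" for e
      unfolding sum_int_interval[OF N] by (rule laurent_eq_form[OF N])
    show ?thesis
    proof
      assume "f \<in> global_sections E"
      then obtain n where n: "degree n \<le> N" "f * ?D = to_fract n"
        using global_sections_iff_polynomial[OF E f] N by auto
      obtain e where e: "n = form N e" using form_surj[OF n(1)] by blast
      have "f = to_fract (form N e) / ?D" using n(2) D unfolding e by (metis nonzero_mult_div_cancel_right)
      also have "\<dots> = (\<Sum>c\<in>{- B..A}. const_fract (e (nat (c + B))) * coord powi c)"
        unfolding laurent by simp
      finally show "\<exists>e. f = (\<Sum>c\<in>{- B..A}. const_fract (e c) * coord powi c)"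
        by (rule exI[of _ "\<lambda>c. e (nat (c + B))"])
    next
      assume "\<exists>e. f = (\<Sum>c\<in>{- B..A}. const_fract (e c) * coord powi c)"
      then obtain e where "f = to_fract (form N e) / ?D" using laurent by blast
      then have "f * ?D = to_fract (form N e)" using D by (metis nonzero_divide_eq_eq)
      moreover have "int (degree (form N e)) \<le> A + B" unfolding N using degree_form by simp
      ultimately show "f \<in> global_sections E" using global_sections_iff_polynomial[OF E f] by blast
    qed
  qed
qed

end

subsection \<open>The canonical ring\<close>

context coordinate begin

definition monomial :: "int \<times> nat \<Rightarrow> 'a poly fract poly" where
  "monomial w = Polynomial.monom (coord powi fst w) (snd w)"

sublocale laurent: monoid_algebra_hom const_fun monomial
proof
  fix x y :: 'a and u w :: "int \<times> nat"
  have "[:x * y:] = [:x:] * [:y:]" by simp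
  then show "const_fun (x * y) = const_fun x * const_fun y"
    unfolding const_fun_def by (simp only: to_fract_mult) simp
  show "const_fun (x + y) = const_fun x + const_fun y"
    unfolding const_fun_def by (simp flip: to_fract_add)
  show "const_fun 1 = (1 :: 'a poly fract poly)" by (simp add: const_fun_def flip: one_pCons)
  show "monomial (u + w) = monomial u * monomial w"
    by (simp add: monomial_def mult_monom power_int_add)
qed (simp_all add: const_fun_def monomial_def)

lemma const_mult_monomial:
  "const_fun x * monomial w = Polynomial.monom (const_fract x * coord powi fst w) (snd w)"
  by (simp add: const_fun_def monomial_def smult_monom)

lemma coeff_lift:
  "Polynomial.coeff (laurent.lift p) n =
     (\<Sum>c\<in>{c. (c, n) \<in> Poly_Mapping.keys p}. const_fract (Poly_Mapping.lookup p (c, n)) * coord powi c)"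
proof -
  have "Polynomial.coeff (laurent.lift p) n = (\<Sum>w\<in>Poly_Mapping.keys p.
      if snd w = n then const_fract (Poly_Mapping.lookup p w) * coord powi fst w else 0)"
    unfolding laurent.lift_def const_mult_monomial by (simp add: coeff_sum)
  also have "\<dots> = (\<Sum>w\<in>{w\<in>Poly_Mapping.keys p. snd w = n}.
      const_fract (Poly_Mapping.lookup p w) * coord powi fst w)"
    by (rule sum.inter_filter[symmetric]) simp
  also have "\<dots> = (\<Sum>c\<in>{c. (c, n) \<in> Poly_Mapping.keys p}.
      const_fract (Poly_Mapping.lookup p (c, n)) * coord powi c)"
    by (rule sum.reindex_bij_witness[of _ "\<lambda>c. (c, n)" fst]) auto
  finally show ?thesis .
qed

text \<open>Powers of \<open>u\<close> separate the degrees, and within one degree distinct powers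
  of the coordinate are independent.\<close>

lemma lift_inj:
  assumes "laurent.lift p = 0"
  shows "p = 0"
proof (rule poly_mapping_eqI)
  fix w :: "int \<times> nat"
  obtain c n where w: "w = (c, n)" by (cases w)
  have "Poly_Mapping.lookup p (c, n) = 0"
  proof (rule ccontr)
    assume "Poly_Mapping.lookup p (c, n) \<noteq> 0"
    then have c: "c \<in> {c. (c, n) \<in> Poly_Mapping.keys p}" by (simp add: in_keys_iff)
    have "{c. (c, n) \<in> Poly_Mapping.keys p} \<subseteq> fst ` Poly_Mapping.keys p" by force
    then have "finite {c. (c, n) \<in> Poly_Mapping.keys p}" by (rule finite_subset) simp
    then have "Poly_Mapping.lookup p (c, n) = 0"
      using laurent_independent[OF _ _ c, of "\<lambda>c. Poly_Mapping.lookup p (c, n)"]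
        coeff_lift[of p n] assms by simp
    with c show False by (simp add: in_keys_iff)
  qed
  then show "Poly_Mapping.lookup p w = Poly_Mapping.lookup 0 w" by (simp add: w)
qed

lemma lookup_floor_multiple:
  "Poly_Mapping.lookup (floor_multiple n (Poly_Mapping.single P \<alpha> + Poly_Mapping.single Q \<beta>)) X =
     \<lfloor>of_nat n * \<alpha>\<rfloor> * of_bool (X = P) + \<lfloor>of_nat n * \<beta>\<rfloor> * of_bool (X = Q)"
  using P_neq_Q
  by (auto simp: floor_multiple_def map.rep_eq lookup_add lookup_single when_def)

text \<open>Rounding a bound does not change which integers satisfy it. Thus the integral part of
  the multiple of the divisor allows exactly the exponents in the corresponding slice of the
  cone.\<close>

lemma emb_mem_cone_points:
  "emb (c, n) \<in> cone_points \<alpha> \<beta> \<longleftrightarrow> c \<in> {- \<lfloor>of_nat n * \<beta>\<rfloor>..\<lfloor>of_nat n * \<alpha>\<rfloor>}"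
proof -
  have "- \<lfloor>of_nat n * \<beta>\<rfloor> \<le> c \<longleftrightarrow> - c \<le> \<lfloor>of_nat n * \<beta>\<rfloor>" by linarith
  also have "\<dots> \<longleftrightarrow> - (of_nat n * \<beta>) \<le> of_int c"
    unfolding le_floor_iff of_int_minus by linarith
  finally have "- \<lfloor>of_nat n * \<beta>\<rfloor> \<le> c \<longleftrightarrow> - (of_nat n * \<beta>) \<le> of_int c" .
  moreover have "c \<le> \<lfloor>of_nat n * \<alpha>\<rfloor> \<longleftrightarrow> of_int c \<le> of_nat n * \<alpha>" by (simp add: le_floor_iff)
  ultimately show ?thesis by (simp add: cone_points_def emb_def mult.commute)
qed

theorem canonical_ring_eq:
  "canonical_ring (Poly_Mapping.single P \<alpha> + Poly_Mapping.single Q \<beta>) =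
     subring_of (laurent.span {w. emb w \<in> cone_points \<alpha> \<beta>})"
proof -
  let ?D = "Poly_Mapping.single P \<alpha> + Poly_Mapping.single Q \<beta>"
  let ?W = "{w. emb w \<in> cone_points \<alpha> \<beta>}"
  let ?I = "\<lambda>n :: nat. {- \<lfloor>of_nat n * \<beta>\<rfloor>..\<lfloor>of_nat n * \<alpha>\<rfloor>}"
  note sections = global_sections_eq[OF lookup_floor_multiple]
  interpret W: class_subring "laurent.span ?W"
    by (rule laurent.class_subring_span) (auto simp: emb_add cone.zero_mem cone.add_mem)
  have "F \<in> laurent.span ?W \<longleftrightarrow> (\<forall>n. Polynomial.coeff F n \<in> global_sections (floor_multiple n ?D))" for F
  proof
    assume "F \<in> laurent.span ?W"
    then obtain p where p: "Poly_Mapping.keys p \<subseteq> ?W" "F = laurent.lift p"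
      by (auto simp: laurent.span_def)
    show "\<forall>n. Polynomial.coeff F n \<in> global_sections (floor_multiple n ?D)"
    proof
      fix n
      \<comment> \<open>The sum over the support is extended to the whole interval; the added
        exponents have coefficient zero.\<close>
      have "Polynomial.coeff F n =
          (\<Sum>c\<in>?I n. const_fract (Poly_Mapping.lookup p (c, n)) * coord powi c)"
        unfolding p(2) coeff_lift
      proof (rule sum.mono_neutral_left)
        show "{c. (c, n) \<in> Poly_Mapping.keys p} \<subseteq> ?I n" using p(1) emb_mem_cone_points by blast
      qed (simp_all add: in_keys_iff)
      then show "Polynomial.coeff F n \<in> global_sections (floor_multiple n ?D)"
        unfolding sections by (rule exI[of _ "\<lambda>c. Poly_Mapping.lookup p (c, n)"])
    qed
  next
    assume F: "\<forall>n. Polynomial.coeff F n \<in> global_sections (floor_multiple n ?D)"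
    \<comment> \<open>It suffices to treat the homogeneous components of \<open>F\<close>, each
      being a combination of monomials from one slice of the cone.\<close>
    have "Polynomial.monom (Polynomial.coeff F n) n \<in> laurent.span ?W" for n
    proof -
      obtain e where e: "Polynomial.coeff F n = (\<Sum>c\<in>?I n. const_fract (e c) * coord powi c)"
        using F sections by blast
      have "Polynomial.monom (Polynomial.coeff F n) n = (\<Sum>c\<in>?I n. const_fun (e c) * monomial (c, n))"
        unfolding e const_mult_monomial by (simp add: monom_sum)
      also have "\<dots> \<in> laurent.span ?W"
        by (intro W.sum_mem laurent.span_single) (simp add: emb_mem_cone_points)
      finally show ?thesis .
    qed
    then have "(\<Sum>n\<le>Polynomial.degree F. Polynomial.monom (Polynomial.coeff F n) n) \<in> laurent.span ?W"
      by (intro W.sum_mem)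
    then show "F \<in> laurent.span ?W" by (simp only: poly_as_sum_of_monoms)
  qed
  then show ?thesis unfolding canonical_ring_def by (auto simp: set_eq_iff)
qed

end

lemma Var_power: "(Var h :: 'a::field mpolynomial) ^ a = Poly_Mapping.single (Poly_Mapping.single h a) 1"
proof (induction a)
  case (Suc a)
  have "(Var h :: 'a mpolynomial) ^ Suc a = Var h * Poly_Mapping.single (Poly_Mapping.single h a) 1" by (simp only: power_Suc Suc)
  then show ?case by (simp add: Var_def mult_single flip: single_add)
qed (simp add: single_one)

theorem theorem6:
  fixes P Q :: "'a::field p1_point" and t :: "'a poly fract"
    and \<alpha> \<beta> :: rat and c :: "int \<Rightarrow> int" and d :: "int \<Rightarrow> nat" and r s :: nat
  defines "q \<equiv> \<lambda>i. of_int (c i) / of_nat (d i) :: rat"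
    and "D \<equiv> Poly_Mapping.single P \<alpha> + Poly_Mapping.single Q \<beta>"
    and "I \<equiv> {- int s .. int r}"
    and "f \<equiv> \<lambda>i. Polynomial.monom (t powi c i) (d i)"
  defines "pairs \<equiv> {(i, j). i \<in> I \<and> j \<in> I \<and> i + 2 \<le> j}"
  assumes "P \<in> rational_points" and "Q \<in> rational_points" and "P \<noteq> Q"
    and "\<alpha> + \<beta> \<ge> 0"
    and "rational_coordinate t" and "place_order P t < 0" and "place_order Q t > 0"
    and "0 < d 0" and "coprime (c 0) (int (d 0))" and "q 0 \<in> {- \<beta> .. \<alpha>}"
    and "\<And>m n. 0 < n \<Longrightarrow> of_int m / of_nat n \<in> {- \<beta> .. \<alpha>} \<Longrightarrow> d 0 \<le> n"
    and "strict_mono_on I q"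
    and "{(c i, d i) |i. 0 < i \<and> i \<le> int r} =
         {(m, n). best_lower_approx \<alpha> m n \<and> q 0 < of_int m / of_nat n}"
    and "q (int r) = \<alpha>"
    and "{(c i, d i) |i. - int s \<le> i \<and> i < 0} =
         {(m, n). best_upper_approx (- \<beta>) m n \<and> of_int m / of_nat n < q 0}"
    and "q (- int s) = - \<beta>"
  shows "\<exists>g.
     card (f ` I) = r + s + 1 \<and>
     card (case_prod g ` pairs) = (r + s) choose 2 \<and>
     (\<forall>(i, j)\<in>pairs.
        (\<exists>h a. i < h \<and> h < j \<and> 0 < a \<and> g i j = Var i * Var j - Var h ^ a) \<or>
        (\<exists>h a b. i < h \<and> h + 1 < j \<and> 0 < a \<and> 0 < b \<and>
           g i j = Var i * Var j - Var h ^ a * Var (h + 1) ^ b)) \<and>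
     minimal_presentation (canonical_ring D) I f (case_prod g ` pairs)"
proof -
  \<comment> \<open>The zero and the pole determine the coordinate up to the scalars
    \<open>k\<close> and \<open>l\<close>.\<close>
  obtain k l where kl: "k \<noteq> 0" "l \<noteq> 0"
    and t: "t = to_fract (smult k (point_poly Q)) / to_fract (smult l (point_poly P))"
    using coordinate_form[OF assms(10,6,7,11,12)] by blast
  interpret coordinate P Q k l by unfold_locales fact+
  have t: "t = coord" by (simp add: t coord_def num_def den_def)
  define v where "v = (\<lambda>i. (c i, int (d i)))"
  interpret hb: hilbert_basis "cone_points \<alpha> \<beta>" v "- int s" "int r"
    unfolding v_def
    by (rule best_approximations_hilbert_basis) (use assms(13-) in \<open>simp_all add: q_def I_def\<close>)
  interpret tp: toric_presentation "cone_points \<alpha> \<beta>" v "- int s" "int r" const_fun monomial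
    by unfold_locales (rule lift_inj)
  have f: "f = (\<lambda>i. monomial (tp.gen i))"
    unfolding tp.gen_def by (simp add: f_def v_def t monomial_def)
  have S: "canonical_ring D = subring_of (laurent.span tp.points)"
    unfolding D_def canonical_ring_eq tp.points_def ..
  have R: "mpoly_ring I = subring_of tp.polys"
    unfolding mpoly_ring_def tp.polys_def tp.exponents_def I_def subset_eq by simp
  have eval: "eval_mpoly f p = tp.ev.lift p" for p
    unfolding eval_mpoly_def tp.ev.lift_def by (simp add: tp.T_val f)
  have kernel: "a_kernel (mpoly_ring I) (canonical_ring D) (eval_mpoly f) =
      {p\<in>tp.polys. tp.ev.lift p = 0}"
    by (simp add: a_kernel_def' R S eval)
  have pairs: "pairs = tp.pairs"
    unfolding pairs_def tp.pairs_def I_def by auto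
  obtain rhs where rhs: "tp.straightening i j (rhs i j)" if "(i, j) \<in> tp.pairs" for i j
    using tp.straightening_exists by metis
  define g where "g = (\<lambda>i j. tp.relator rhs (i, j))"
  have g: "case_prod g = tp.relator rhs" by (auto simp: g_def)
  have "inj_on f I"
    using tp.T_eq_iff tp.gen_eq_iff by (intro inj_onI) (auto simp: f I_def)
  then have card_f: "card (f ` I) = r + s + 1" by (simp add: card_image I_def)
  \<comment> \<open>Writing the upper index as \<open>- s + (r + s)\<close> exhibits the length
    \<open>r + s\<close> on which the count depends.\<close>
  have "tp.pairs = {(i, j). - int s \<le> i \<and> i + 2 \<le> j \<and> j \<le> - int s + int (r + s)}"
    by (auto simp: tp.pairs_def)
  then have "card tp.pairs = (r + s) choose 2" by (simp only: card_separated_pairs)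
  then have card_g: "card (case_prod g ` pairs) = (r + s) choose 2"
    unfolding g pairs using tp.inj_on_relator[OF rhs] by (simp add: card_image)
  have form: "(\<exists>h a. i < h \<and> h < j \<and> 0 < a \<and> g i j = Var i * Var j - Var h ^ a) \<or>
      (\<exists>h a b. i < h \<and> h + 1 < j \<and> 0 < a \<and> 0 < b \<and>
         g i j = Var i * Var j - Var h ^ a * Var (h + 1) ^ b)" if ij: "(i, j) \<in> pairs" for i j
  proof -
    have lhs: "mon (tp.pair_exp i j) = Var i * Var j"
      by (simp add: tp.pair_exp_def Var_def mult_single)
    have "tp.straightening i j (rhs i j)" using rhs ij pairs by blast
    then consider h a where "i < h" "h < j" "2 \<le> a" "rhs i j = Poly_Mapping.single h a"
      | h a b where "i < h" "h + 1 < j" "0 < a" "0 < b"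
        "rhs i j = Poly_Mapping.single h a + Poly_Mapping.single (h + 1) b"
      unfolding tp.straightening_def by blast
    then show ?thesis
    proof cases
      case 1
      then have "g i j = Var i * Var j - Var h ^ a"
        by (simp add: g_def tp.relator_def lhs Var_power)
      moreover have "0 < a" using 1(3) by simp
      ultimately show ?thesis using 1(1,2) by blast
    next
      case 2
      then have "g i j = Var i * Var j - Var h ^ a * Var (h + 1) ^ b"
        by (simp add: g_def tp.relator_def lhs Var_power mult_single)
      then show ?thesis using 2(1-4) by blast
    qed
  qed
  have generators: "minimal_generators (canonical_ring D) I f"
    unfolding minimal_generators_def generates_algebra_def
  proof (intro conjI allI impI notI)
    show "f ` I \<subseteq> carrier (canonical_ring D)"
      by (auto simp: S f I_def intro!: tp.T_mem_span tp.gen_points)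
    show "generate_ring (canonical_ring D) (range const_fun \<union> f ` I) = carrier (canonical_ring D)"
      using tp.generators by (simp add: S f I_def)
    fix J assume "J \<subset> I" "f ` J \<subseteq> carrier (canonical_ring D) \<and>
      generate_ring (canonical_ring D) (range const_fun \<union> f ` J) = carrier (canonical_ring D)"
    then show False using tp.generators_minimal[of J] by (simp add: S f I_def)
  qed
  have "minimal_ideal_generators (mpoly_ring I)
      (a_kernel (mpoly_ring I) (canonical_ring D) (eval_mpoly f)) (case_prod g ` pairs)"
    unfolding minimal_ideal_generators_def kernel
  proof (intro conjI allI impI)
    show "case_prod g ` pairs \<subseteq> carrier (mpoly_ring I)"
      unfolding g pairs R using tp.relator_mem rhs by auto
    show "Idl\<^bsub>mpoly_ring I\<^esub> (case_prod g ` pairs) = {p\<in>tp.polys. tp.ev.lift p = 0}"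
      unfolding g pairs R by (rule tp.genideal_relators[OF rhs])
    show "Idl\<^bsub>mpoly_ring I\<^esub> H \<noteq> {p\<in>tp.polys. tp.ev.lift p = 0}" if "H \<subset> case_prod g ` pairs" for H
      using tp.relators_minimal[OF rhs, of H] that unfolding g pairs R by blast
  qed
  with generators have "minimal_presentation (canonical_ring D) I f (case_prod g ` pairs)"
    by (simp add: minimal_presentation_def)
  with card_f card_g form show ?thesis by blast
qed

end
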